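(* Let $G$ be a finite group, $p$ a prime, and $\mathcal C$ a collection of $p$-subgroups of $G$ (closed under conjugation) that is closed under taking $p$-overgroups. Then for every $P\in\mathcal C$ the orbit space $C_G(P)\backslash(E_{\mathcal C}G)^P$ is $\mathbb Z_{(p)}$-acyclic.
   Context: Closed under taking $p$-overgroups: if $P\in\mathcal C$ and $P\le Q$ with $Q$ a $p$-subgroup of $G$, then $Q\in\mathcal C$. The orbit category $\mathcal O_{\mathcal C}(G)$ has objects $H\in\mathcal C$ and morphisms $H\to K$ the $G$-maps $G/H\to G/K$. $E_{\mathcal C}G=X^\beta_{\mathcal C}$, the Dwyer space for the subgroup decomposition, is the $G$-space $\mathrm{hocolim}_{H\in\mathcal O_{\mathcal C}(G)}G/H$; equivalently, the nerve of the category with objects $(H,xH)$, $H\in\mathcal C$, $xH\in G/H$, and morphisms $(H,xH)\to(K,yK)$ the $G$-maps $f:G/H\to G/K$ with $f(xH)=yK$, where $G$ acts by $g(H,xH)=(H,gxH)$. A space is $\mathbb Z_{(p)}$-acyclic if it has the $\mathbb Z_{(p)}$-homology of a point. *)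

theory Defs
  imports "HOL-Algebra.Algebra" "HOL-Library.Poly_Mapping" "HOL-Computational_Algebra.Primes"
begin

section \<open>Simplicial sets\<close>

text \<open>
  Spaces are simplicial sets. For a monotone map \<open>\<theta>\<close> from \<open>{..m}\<close> to \<open>{..n}\<close>, the operator
  \<open>smap Y n m \<theta>\<close> is the induced map from \<open>n\<close>-simplices to \<open>m\<close>-simplices; the values of \<open>\<theta>\<close>
  outside \<open>{..m}\<close> are irrelevant.
\<close>

record 's sset =
  simplices :: "nat \<Rightarrow> 's set"
  smap :: "nat \<Rightarrow> nat \<Rightarrow> (nat \<Rightarrow> nat) \<Rightarrow> 's \<Rightarrow> 's"

definition monotone_map :: "nat \<Rightarrow> nat \<Rightarrow> (nat \<Rightarrow> nat) \<Rightarrow> bool" where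
  "monotone_map m n \<theta> \<longleftrightarrow> \<theta> \<in> {..m} \<rightarrow> {..n} \<and> mono_on {..m} \<theta>"

definition simplicial_set :: "'s sset \<Rightarrow> bool" where
  "simplicial_set Y \<longleftrightarrow>
     (\<forall>n m \<theta>. monotone_map m n \<theta> \<longrightarrow> smap Y n m \<theta> \<in> simplices Y n \<rightarrow> simplices Y m) \<and>
     (\<forall>n m \<theta> \<theta>'. monotone_map m n \<theta> \<and> monotone_map m n \<theta>' \<and> (\<forall>i\<le>m. \<theta> i = \<theta>' i) \<longrightarrow>
        (\<forall>s\<in>simplices Y n. smap Y n m \<theta> s = smap Y n m \<theta>' s)) \<and>
     (\<forall>n. \<forall>s\<in>simplices Y n. smap Y n n id s = s) \<and>
     (\<forall>n m l \<theta> \<eta>. monotone_map m n \<theta> \<and> monotone_map l m \<eta> \<longrightarrow>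
        (\<forall>s\<in>simplices Y n. smap Y n l (\<theta> \<circ> \<eta>) s = smap Y m l \<eta> (smap Y n m \<theta> s)))"

definition coface :: "nat \<Rightarrow> nat \<Rightarrow> nat" where
  "coface i j = (if j < i then j else Suc j)"

definition face :: "'s sset \<Rightarrow> nat \<Rightarrow> nat \<Rightarrow> 's \<Rightarrow> 's" where
  "face Y n i = smap Y n (n - 1) (coface i)"

definition point_sset :: "unit sset" where
  "point_sset = \<lparr>simplices = (\<lambda>n. {()}), smap = (\<lambda>n m \<theta> s. s)\<rparr>"

text \<open>
  A levelwise action is a family \<open>\<phi>\<close> in which \<open>\<phi> n g\<close> is the effect of \<open>g\<close> on \<open>n\<close>-simplices.
  On orbits the simplicial operators act by taking images of sets of simplices.
\<close>

definition fixed_points :: "'s sset \<Rightarrow> (nat \<Rightarrow> 'g \<Rightarrow> 's \<Rightarrow> 's) \<Rightarrow> 'g set \<Rightarrow> 's sset" where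
  "fixed_points Y \<phi> P =
     \<lparr>simplices = (\<lambda>n. {s \<in> simplices Y n. \<forall>g\<in>P. \<phi> n g s = s}), smap = smap Y\<rparr>"

definition orbit_space ::
    "('g, 'b) monoid_scheme \<Rightarrow> 'g set \<Rightarrow> (nat \<Rightarrow> 'g \<Rightarrow> 's \<Rightarrow> 's) \<Rightarrow> 's sset \<Rightarrow> 's set sset" where
  "orbit_space G Q \<phi> Y =
     \<lparr>simplices = (\<lambda>n. orbits (G\<lparr>carrier := Q\<rparr>) (simplices Y n) (\<phi> n)),
      smap = (\<lambda>n m \<theta>. image (smap Y n m \<theta>))\<rparr>"


lemma simplicial_set_fixed_points:
  assumes Y: "simplicial_set Y"
    and c: "\<And>n m \<theta> g s. monotone_map m n \<theta> \<Longrightarrow> s \<in> simplices Y n \<Longrightarrow> g \<in> P \<Longrightarrow>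
              smap Y n m \<theta> (\<phi> n g s) = \<phi> m g (smap Y n m \<theta> s)"
  shows "simplicial_set (fixed_points Y \<phi> P)"
  using Y c unfolding simplicial_set_def fixed_points_def Pi_def
  by simp (metis (lifting))

lemma simplicial_set_orbit_space:
  assumes Y: "simplicial_set Y"
    and cl: "\<And>n g s. s \<in> simplices Y n \<Longrightarrow> g \<in> Q \<Longrightarrow> \<phi> n g s \<in> simplices Y n"
    and c: "\<And>n m \<theta> g s. monotone_map m n \<theta> \<Longrightarrow> s \<in> simplices Y n \<Longrightarrow> g \<in> Q \<Longrightarrow>
              smap Y n m \<theta> (\<phi> n g s) = \<phi> m g (smap Y n m \<theta> s)"
  shows "simplicial_set (orbit_space G Q \<phi> Y)"
proof -
  have o: "orbit (G\<lparr>carrier := Q\<rparr>) (\<phi> n) s = (\<lambda>g. \<phi> n g s) ` Q" for n s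
    by (auto simp: orbit_def)
  have im: "smap Y n m \<theta> ` ((\<lambda>g. \<phi> n g s) ` Q) = (\<lambda>g. \<phi> m g (smap Y n m \<theta> s)) ` Q"
    if "monotone_map m n \<theta>" "s \<in> simplices Y n" for n m \<theta> s
    using c[OF that] by (simp add: image_image)
  have a: "smap Y n m \<theta> s \<in> simplices Y m" if "monotone_map m n \<theta>" "s \<in> simplices Y n" for n m \<theta> s
    using Y that unfolding simplicial_set_def by blast
  have b: "smap Y n m \<theta> s = smap Y n m \<theta>' s" if "monotone_map m n \<theta>" "monotone_map m n \<theta>'" "\<forall>i\<le>m. \<theta> i = \<theta>' i" "s \<in> simplices Y n" for n m \<theta> \<theta>' s
    using Y that unfolding simplicial_set_def by blast
  have d: "smap Y n n id s = s" if "s \<in> simplices Y n" for n s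
    using Y that unfolding simplicial_set_def by blast
  have e: "smap Y n l (\<theta> \<circ> \<eta>) s = smap Y m l \<eta> (smap Y n m \<theta> s)"
    if "monotone_map m n \<theta>" "monotone_map l m \<eta>" "s \<in> simplices Y n" for n m l \<theta> \<eta> s
    using Y that unfolding simplicial_set_def by blast
  have S: "simplices (orbit_space G Q \<phi> Y) n = {(\<lambda>g. \<phi> n g s) ` Q |s. s \<in> simplices Y n}" for n
    by (simp add: orbit_space_def orbits_def o)
  have M: "smap (orbit_space G Q \<phi> Y) n m \<theta> = image (smap Y n m \<theta>)" for n m \<theta>
    by (simp add: orbit_space_def)
  show ?thesis
    unfolding simplicial_set_def S M
  proof (intro conjI allI impI ballI)
    fix n m \<theta> assume "monotone_map m n \<theta>"
    then show "(`) (smap Y n m \<theta>) \<in> {(\<lambda>g. \<phi> n g s) ` Q |s. s \<in> simplices Y n} \<rightarrow> {(\<lambda>g. \<phi> m g s) ` Q |s. s \<in> simplices Y m}"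
      using a im by fastforce
  next
    fix n m \<theta> \<theta>' s
    assume "monotone_map m n \<theta> \<and> monotone_map m n \<theta>' \<and> (\<forall>i\<le>m. \<theta> i = \<theta>' i)"
      "s \<in> {(\<lambda>g. \<phi> n g s) ` Q |s. s \<in> simplices Y n}"
    then show "smap Y n m \<theta> ` s = smap Y n m \<theta>' ` s"
      by (intro image_cong refl b) (auto intro: cl)
  next
    fix n s assume "s \<in> {(\<lambda>g. \<phi> n g s) ` Q |s. s \<in> simplices Y n}"
    then show "smap Y n n id ` s = s"
      using cl d by (auto simp: image_image)
  next
    fix n m l \<theta> \<eta> s
    assume "monotone_map m n \<theta> \<and> monotone_map l m \<eta>" "s \<in> {(\<lambda>g. \<phi> n g s) ` Q |s. s \<in> simplices Y n}"
    then show "smap Y n l (\<theta> \<circ> \<eta>) ` s = smap Y m l \<eta> ` smap Y n m \<theta> ` s"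
      unfolding image_image by (intro image_cong refl e) (auto intro: cl)
  qed
qed


section \<open>Homology with coefficients\<close>

text \<open>
  \<open>R\<close> is a subring of the type \<open>'r\<close>, and \<open>n\<close>-chains are finitely supported functions from
  \<open>n\<close>-simplices to \<open>R\<close> (the unnormalised chain complex, degenerate simplices included).
\<close>

definition chains :: "'r::comm_ring_1 set \<Rightarrow> 's sset \<Rightarrow> nat \<Rightarrow> ('s \<Rightarrow>\<^sub>0 'r) set" where
  "chains R Y n = {c. Poly_Mapping.keys c \<subseteq> simplices Y n \<and> range (Poly_Mapping.lookup c) \<subseteq> R}"

definition boundary :: "'s sset \<Rightarrow> nat \<Rightarrow> ('s \<Rightarrow>\<^sub>0 'r::comm_ring_1) \<Rightarrow> ('s \<Rightarrow>\<^sub>0 'r)" where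
  "boundary Y n c =
     (if n = 0 then 0
      else \<Sum>s\<in>Poly_Mapping.keys c. \<Sum>i\<le>n.
             Poly_Mapping.single (face Y n i s) ((-1) ^ i * Poly_Mapping.lookup c s))"

definition cycle_group :: "'r::comm_ring_1 set \<Rightarrow> 's sset \<Rightarrow> nat \<Rightarrow> ('s \<Rightarrow>\<^sub>0 'r) monoid" where
  "cycle_group R Y n =
     \<lparr>carrier = {c \<in> chains R Y n. boundary Y n c = 0}, monoid.mult = (+), one = 0\<rparr>"

definition homology_with ::
    "'r::comm_ring_1 set \<Rightarrow> 's sset \<Rightarrow> nat \<Rightarrow> ('s \<Rightarrow>\<^sub>0 'r) set monoid" where
  "homology_with R Y n = cycle_group R Y n Mod (boundary Y (Suc n) ` chains R Y (Suc n))"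

definition Z_localized :: "nat \<Rightarrow> rat set" where
  "Z_localized p = {of_int a / of_int b | a b. \<not> int p dvd b}"

text \<open>
  Additive maps between modules over \<open>Z_localized p\<close> are automatically linear, so isomorphism
  of abelian groups is the same as isomorphism of modules here.
\<close>

definition Zp_acyclic :: "nat \<Rightarrow> 's sset \<Rightarrow> bool" where
  "Zp_acyclic p Y \<longleftrightarrow>
     (\<forall>n. homology_with (Z_localized p) Y n \<cong> homology_with (Z_localized p) point_sset n)"


section \<open>Nerves\<close>

record ('o, 'm) category =
  Obj :: "'o set"
  Hom :: "'o \<Rightarrow> 'o \<Rightarrow> 'm set"
  Ident :: "'o \<Rightarrow> 'm"
  Comp :: "'o \<Rightarrow> 'o \<Rightarrow> 'o \<Rightarrow> 'm \<Rightarrow> 'm \<Rightarrow> 'm"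

text \<open>
  \<open>Comp x y z g f\<close> is the composite of \<open>f\<close> from \<open>x\<close> to \<open>y\<close> followed by \<open>g\<close> from \<open>y\<close> to \<open>z\<close>.

  An \<open>n\<close>-simplex of the nerve is a functor from the poset \<open>{..n}\<close>: a pair \<open>(ob, mor)\<close> with
  \<open>mor i j\<close> the morphism from \<open>ob i\<close> to \<open>ob j\<close> for \<open>i \<le> j \<le> n\<close>. Both components take the
  value \<open>undefined\<close> elsewhere, so that equality of pairs is equality of functors.
\<close>

type_synonym ('o, 'm) nerve_simplex = "(nat \<Rightarrow> 'o) \<times> (nat \<Rightarrow> nat \<Rightarrow> 'm)"

definition nerve :: "('o, 'm) category \<Rightarrow> ('o, 'm) nerve_simplex sset" where
  "nerve D =
     \<lparr>simplices = (\<lambda>n. {(ob, mor).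
        ob \<in> {..n} \<rightarrow>\<^sub>E Obj D \<and>
        (\<forall>i j. i \<le> j \<and> j \<le> n \<longrightarrow> mor i j \<in> Hom D (ob i) (ob j)) \<and>
        (\<forall>i j. \<not> (i \<le> j \<and> j \<le> n) \<longrightarrow> mor i j = undefined) \<and>
        (\<forall>i\<le>n. mor i i = Ident D (ob i)) \<and>
        (\<forall>i j k. i \<le> j \<and> j \<le> k \<and> k \<le> n \<longrightarrow>
           mor i k = Comp D (ob i) (ob j) (ob k) (mor j k) (mor i j))}),
      smap = (\<lambda>n m \<theta> (ob, mor).
        (\<lambda>i\<in>{..m}. ob (\<theta> i),
         \<lambda>i j. if i \<le> j \<and> j \<le> m then mor (\<theta> i) (\<theta> j) else undefined))\<rparr>"


lemma simplicial_set_nerve: "simplicial_set (nerve D)"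
  unfolding simplicial_set_def
proof (intro conjI allI impI ballI)
  fix n m \<theta> assume th: "monotone_map m n \<theta>"
  then have a: "\<And>i. i \<le> m \<Longrightarrow> \<theta> i \<le> n" and b: "\<And>i j. i \<le> j \<Longrightarrow> j \<le> m \<Longrightarrow> \<theta> i \<le> \<theta> j"
    by (auto simp: monotone_map_def mono_on_def Pi_def)
  show "smap (nerve D) n m \<theta> \<in> simplices (nerve D) n \<rightarrow> simplices (nerve D) m"
  proof
    fix s assume "s \<in> simplices (nerve D) n"
    then show "smap (nerve D) n m \<theta> s \<in> simplices (nerve D) m"
      using a b by (auto simp: nerve_def PiE_def Pi_def extensional_def)
  qed
next
  fix n m \<theta> \<theta>' s
  assume "monotone_map m n \<theta> \<and> monotone_map m n \<theta>' \<and> (\<forall>i\<le>m. \<theta> i = \<theta>' i)"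
    "s \<in> simplices (nerve D) n"
  then show "smap (nerve D) n m \<theta> s = smap (nerve D) n m \<theta>' s"
    by (auto simp: nerve_def fun_eq_iff split: prod.split)
next
  fix n s assume "s \<in> simplices (nerve D) n"
  then show "smap (nerve D) n n id s = s"
    by (auto simp: nerve_def fun_eq_iff PiE_def extensional_def split: prod.split)
next
  fix n m l \<theta> \<eta> s
  assume h: "monotone_map m n \<theta> \<and> monotone_map l m \<eta>" "s \<in> simplices (nerve D) n"
  then have "\<And>i. i \<le> l \<Longrightarrow> \<eta> i \<le> m" and "\<And>i j. i \<le> j \<Longrightarrow> j \<le> l \<Longrightarrow> \<eta> i \<le> \<eta> j"
    by (auto simp: monotone_map_def mono_on_def Pi_def)
  then show "smap (nerve D) n l (\<theta> \<circ> \<eta>) s = smap (nerve D) m l \<eta> (smap (nerve D) n m \<theta> s)"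
    by (auto simp: nerve_def fun_eq_iff split: prod.split)
qed


section \<open>The space \<open>E\<^sub>C G\<close>\<close>

definition G_maps ::
    "('a, 'b) monoid_scheme \<Rightarrow> 'a set \<Rightarrow> 'a set \<Rightarrow> ('a set \<Rightarrow> 'a set) set" where
  "G_maps G H K =
     {f \<in> lcosets\<^bsub>G\<^esub> H \<rightarrow>\<^sub>E lcosets\<^bsub>G\<^esub> K.
        \<forall>g\<in>carrier G. \<forall>A\<in>lcosets\<^bsub>G\<^esub> H. f (g <#\<^bsub>G\<^esub> A) = g <#\<^bsub>G\<^esub> f A}"

definition pointed_orbit_category ::
    "('a, 'b) monoid_scheme \<Rightarrow> 'a set set \<Rightarrow> ('a set \<times> 'a set, 'a set \<Rightarrow> 'a set) category" where
  "pointed_orbit_category G \<C> =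
     \<lparr>Obj = {(H, A). H \<in> \<C> \<and> A \<in> lcosets\<^bsub>G\<^esub> H},
      Hom = (\<lambda>(H, A) (K, B). {f \<in> G_maps G H K. f A = B}),
      Ident = (\<lambda>(H, A). \<lambda>Y\<in>lcosets\<^bsub>G\<^esub> H. Y),
      Comp = (\<lambda>(H, A) y z g f. compose (lcosets\<^bsub>G\<^esub> H) g f)\<rparr>"

definition E_space ::
    "('a, 'b) monoid_scheme \<Rightarrow> 'a set set \<Rightarrow>
      ('a set \<times> 'a set, 'a set \<Rightarrow> 'a set) nerve_simplex sset" where
  "E_space G \<C> = nerve (pointed_orbit_category G \<C>)"

text \<open>
  \<open>G\<close> acts on the category by \<open>g(H, xH) = (H, gxH)\<close>; a morphism is sent to the same
  underlying \<open>G\<close>-map, now between the translated objects.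
\<close>

definition E_action ::
    "('a, 'b) monoid_scheme \<Rightarrow> nat \<Rightarrow> 'a \<Rightarrow>
      ('a set \<times> 'a set, 'a set \<Rightarrow> 'a set) nerve_simplex \<Rightarrow>
      ('a set \<times> 'a set, 'a set \<Rightarrow> 'a set) nerve_simplex" where
  "E_action G n g = (\<lambda>(ob, mor).
     (\<lambda>i\<in>{..n}. case ob i of (H, A) \<Rightarrow> (H, g <#\<^bsub>G\<^esub> A), mor))"


lemma E_action_smap:
  assumes "monotone_map m n \<theta>"
  shows "smap (E_space G \<C>) n m \<theta> (E_action G n g s) = E_action G m g (smap (E_space G \<C>) n m \<theta> s)"
  using assms by (auto simp: E_space_def nerve_def E_action_def monotone_map_def Pi_def fun_eq_iff split: prod.split)


section \<open>Collections of \<open>p\<close>-subgroups\<close>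

definition centralizer :: "('a, 'b) monoid_scheme \<Rightarrow> 'a set \<Rightarrow> 'a set" where
  "centralizer G P = {g \<in> carrier G. \<forall>h\<in>P. g \<otimes>\<^bsub>G\<^esub> h = h \<otimes>\<^bsub>G\<^esub> g}"

definition p_subgroup :: "nat \<Rightarrow> 'a set \<Rightarrow> ('a, 'b) monoid_scheme \<Rightarrow> bool" where
  "p_subgroup p H G \<longleftrightarrow> subgroup H G \<and> (\<exists>k. card H = p ^ k)"

definition p_collection :: "nat \<Rightarrow> ('a, 'b) monoid_scheme \<Rightarrow> 'a set set \<Rightarrow> bool" where
  "p_collection p G \<C> \<longleftrightarrow>
     (\<forall>H\<in>\<C>. p_subgroup p H G) \<and>
     (\<forall>H\<in>\<C>. \<forall>g\<in>carrier G. g <#\<^bsub>G\<^esub> H #>\<^bsub>G\<^esub> inv\<^bsub>G\<^esub> g \<in> \<C>)"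

definition closed_under_p_overgroups :: "nat \<Rightarrow> ('a, 'b) monoid_scheme \<Rightarrow> 'a set set \<Rightarrow> bool" where
  "closed_under_p_overgroups p G \<C> \<longleftrightarrow>
     (\<forall>P\<in>\<C>. \<forall>Q. p_subgroup p Q G \<and> P \<subseteq> Q \<longrightarrow> Q \<in> \<C>)"

end

theory Submission
  imports Defs
begin

text \<open>
  Let \<open>X\<close> be the fixed point space of \<open>P\<close> in \<open>E\<^sub>C G\<close>, let \<open>K = C\<^sub>G(P)\<close>, and let \<open>S\<close> be a
  Sylow \<open>p\<close>-subgroup of \<open>K\<close>. If \<open>Q \<le> S\<close>, then \<open>PQ\<close> is a \<open>p\<close>-subgroup containing \<open>P\<close>, so it belongs
  to the collection, and the fixed points of \<open>Q\<close> on \<open>X\<close> are those of \<open>PQ\<close> on \<open>E\<^sub>C G\<close>. They form the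
  nerve of a category with initial object \<open>(PQ, PQ)\<close> and are contractible. As this holds for every
  \<open>Q \<le> S\<close>, the chains of \<open>X\<close> have an \<open>S\<close>-equivariant contraction. Transfer from \<open>X\<close> to its orbit
  space under \<open>K\<close> then shows that the orbit space is acyclic once the index of \<open>S\<close> in \<open>K\<close>, which is
  prime to \<open>p\<close>, is inverted.
\<close>

section \<open>Linear extension\<close>

text \<open>Transfer along a contraction that ignores the group would only show that
  \<open>|K|\<close> annihilates the reduced homology of the orbit space, and \<open>p\<close> may
  divide \<open>|K|\<close>. The Sylow factor must therefore be removed without inverting it, and
  this is what equivariance under \<open>S\<close> provides. Equivariance cannot be arranged
  afterwards by averaging, since that would again divide by a power of \<open>p\<close>. Instead the
  value on a simplex is sought from the start among chains of simplices fixed by its stabiliser.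
  This is why acyclicity is required of the fixed points of every subgroup of \<open>S\<close>, and
  not of \<open>X\<close> alone. Nor can \<open>S\<close> be replaced by \<open>K\<close>: a
  stabiliser \<open>Q\<close> in \<open>K\<close> need not be a \<open>p\<close>-group, and then
  \<open>PQ\<close> is outside the collection, so that the cone construction has no apex.\<close>

definition scale :: "'r::comm_ring_1 \<Rightarrow> ('s \<Rightarrow>\<^sub>0 'r) \<Rightarrow> ('s \<Rightarrow>\<^sub>0 'r)" where
  "scale r c = Poly_Mapping.map ((*) r) c"

lemma lookup_scale [simp]: "Poly_Mapping.lookup (scale r c) x = r * Poly_Mapping.lookup c x"
  by (simp add: scale_def map.rep_eq when_def)

lemma scale_zero [simp]: "scale r 0 = 0"
  by (rule poly_mapping_eqI) simp

lemma scale_one [simp]: "scale 1 c = c"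
  by (rule poly_mapping_eqI) simp

lemma scale_scale [simp]: "scale a (scale b c) = scale (a * b) c"
  by (rule poly_mapping_eqI) (simp add: mult.assoc)

lemma scale_single [simp]: "scale r (Poly_Mapping.single s a) = Poly_Mapping.single s (r * a)"
  by (rule poly_mapping_eqI) (simp add: lookup_single when_def)

lemma scale_sum: "scale r (\<Sum>i\<in>I. f i) = (\<Sum>i\<in>I. scale r (f i))"
  by (rule poly_mapping_eqI) (simp add: lookup_sum sum_distrib_left)

lemma keys_scale: "Poly_Mapping.keys (scale r c) \<subseteq> Poly_Mapping.keys c"
  by (auto simp: in_keys_iff)

definition linear_extension :: "('s \<Rightarrow> 't \<Rightarrow>\<^sub>0 'r) \<Rightarrow> ('s \<Rightarrow>\<^sub>0 'r) \<Rightarrow> ('t \<Rightarrow>\<^sub>0 'r::comm_ring_1)" where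
  "linear_extension f c = (\<Sum>s\<in>Poly_Mapping.keys c. scale (Poly_Mapping.lookup c s) (f s))"

text \<open>A common finite set containing the supports of several chains turns identities between
  them into termwise identities.\<close>

lemma lookup_linear_extension:
  assumes "finite A" "Poly_Mapping.keys c \<subseteq> A"
  shows "Poly_Mapping.lookup (linear_extension f c) t =
    (\<Sum>s\<in>A. Poly_Mapping.lookup c s * Poly_Mapping.lookup (f s) t)"
proof -
  have "Poly_Mapping.lookup (linear_extension f c) t =
    (\<Sum>s\<in>Poly_Mapping.keys c. Poly_Mapping.lookup c s * Poly_Mapping.lookup (f s) t)"
    by (simp add: linear_extension_def lookup_sum)
  also have "\<dots> = (\<Sum>s\<in>A. Poly_Mapping.lookup c s * Poly_Mapping.lookup (f s) t)"
    using assms by (intro sum.mono_neutral_left) (auto simp: in_keys_iff)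
  finally show ?thesis .
qed

lemma linear_extension_cong:
  assumes "\<And>s. s \<in> Poly_Mapping.keys c \<Longrightarrow> f s = g s"
  shows "linear_extension f c = linear_extension g c"
  using assms by (simp add: linear_extension_def)

lemma linear_extension_zero [simp]: "linear_extension f 0 = 0"
  by (simp add: linear_extension_def)

lemma linear_extension_zero_fun [simp]: "linear_extension (\<lambda>s. 0) c = 0"
  by (simp add: linear_extension_def)

lemma linear_extension_add: "linear_extension f (c + d) = linear_extension f c + linear_extension f d"
proof (rule poly_mapping_eqI)
  let ?A = "Poly_Mapping.keys c \<union> Poly_Mapping.keys d"
  fix t
  show "Poly_Mapping.lookup (linear_extension f (c + d)) t =
    Poly_Mapping.lookup (linear_extension f c + linear_extension f d) t"
    using keys_add[of c d]
    by (simp add: lookup_linear_extension[of ?A] lookup_add distrib_right sum.distrib)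
qed

lemma linear_extension_scale: "linear_extension f (scale r c) = scale r (linear_extension f c)"
proof (rule poly_mapping_eqI)
  fix t
  show "Poly_Mapping.lookup (linear_extension f (scale r c)) t =
    Poly_Mapping.lookup (scale r (linear_extension f c)) t"
    using keys_scale[of r c]
    by (simp add: lookup_linear_extension[of "Poly_Mapping.keys c"] sum_distrib_left mult.assoc)
qed

lemma linear_extension_diff: "linear_extension f (c - d) = linear_extension f c - linear_extension f d"
  using linear_extension_add[of f "c - d" d] by simp

lemma linear_extension_sum: "linear_extension f (\<Sum>i\<in>I. c i) = (\<Sum>i\<in>I. linear_extension f (c i))"
  by (induction I rule: infinite_finite_induct) (simp_all add: linear_extension_add)

lemma linear_extension_single [simp]:
  "linear_extension f (Poly_Mapping.single s r) = scale r (f s)"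
proof (rule poly_mapping_eqI)
  fix t
  show "Poly_Mapping.lookup (linear_extension f (Poly_Mapping.single s r)) t =
    Poly_Mapping.lookup (scale r (f s)) t"
    by (simp add: lookup_linear_extension[of "{s}"])
qed

lemma linear_extension_linear_extension:
  "linear_extension f (linear_extension g c) = linear_extension (\<lambda>s. linear_extension f (g s)) c"
  by (subst (2) linear_extension_def)
    (simp add: linear_extension_def[of "\<lambda>s. linear_extension f (g s)"] linear_extension_sum linear_extension_scale)

lemma linear_extension_fun_diff:
  "linear_extension (\<lambda>s. f s - g s) c = linear_extension f c - linear_extension g c"
  by (rule poly_mapping_eqI)
    (simp add: lookup_linear_extension[OF finite_keys subset_refl] lookup_minus right_diff_distrib sum_subtractf)

lemma linear_extension_fun_scale:
  "linear_extension (\<lambda>s. scale r (f s)) c = scale r (linear_extension f c)"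
  by (rule poly_mapping_eqI)
    (simp add: lookup_linear_extension[OF finite_keys subset_refl] sum_distrib_left mult.left_commute)

lemma linear_extension_basis [simp]: "linear_extension (\<lambda>s. Poly_Mapping.single s 1) c = c"
  by (rule poly_mapping_eqI)
    (simp add: lookup_linear_extension[OF finite_keys subset_refl] lookup_single when_def in_keys_iff
      if_distrib[of "(*) _"] cong: if_cong)

text \<open>The map induced on chains by a map of simplices.\<close>

abbreviation push :: "('s \<Rightarrow> 't) \<Rightarrow> ('s \<Rightarrow>\<^sub>0 'r) \<Rightarrow> ('t \<Rightarrow>\<^sub>0 'r::comm_ring_1)" where
  "push f \<equiv> linear_extension (\<lambda>s. Poly_Mapping.single (f s) 1)"

section \<open>Chains and boundaries\<close>

text \<open>The coefficients are a subset of an ambient type, so that division can take place in an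
  ambient field and only its outcome has to be shown to lie in \<open>R\<close>.\<close>

locale coefficient_ring =
  fixes R :: "'r::comm_ring_1 set"
  assumes zero_mem [simp]: "0 \<in> R" and one_mem [simp]: "1 \<in> R"
    and add_mem: "a \<in> R \<Longrightarrow> b \<in> R \<Longrightarrow> a + b \<in> R"
    and uminus_mem: "a \<in> R \<Longrightarrow> - a \<in> R"
    and mult_mem: "a \<in> R \<Longrightarrow> b \<in> R \<Longrightarrow> a * b \<in> R"
begin

lemma sign_mem: "(-1) ^ i \<in> R"
  by (induction i) (auto intro: uminus_mem)

lemma zero_chains [simp]: "0 \<in> chains R Y n"
  by (auto simp: chains_def)

lemma single_chains: "s \<in> simplices Y n \<Longrightarrow> r \<in> R \<Longrightarrow> Poly_Mapping.single s r \<in> chains R Y n"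
  by (auto simp: chains_def lookup_single when_def)

lemma add_chains: "c \<in> chains R Y n \<Longrightarrow> d \<in> chains R Y n \<Longrightarrow> c + d \<in> chains R Y n"
  using keys_add[of c d] by (auto simp: chains_def lookup_add intro!: add_mem)

lemma uminus_chains: "c \<in> chains R Y n \<Longrightarrow> - c \<in> chains R Y n"
  by (auto simp: chains_def intro!: uminus_mem)

lemma diff_chains: "c \<in> chains R Y n \<Longrightarrow> d \<in> chains R Y n \<Longrightarrow> c - d \<in> chains R Y n"
  using add_chains[of c Y n "- d"] uminus_chains[of d] by simp

lemma sum_chains: "(\<And>i. i \<in> I \<Longrightarrow> f i \<in> chains R Y n) \<Longrightarrow> sum f I \<in> chains R Y n"
  by (induction I rule: infinite_finite_induct) (auto intro: add_chains)

lemma scale_chains: "r \<in> R \<Longrightarrow> c \<in> chains R Y n \<Longrightarrow> scale r c \<in> chains R Y n"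
  using keys_scale[of r c] by (auto simp: chains_def intro!: mult_mem)

lemma linear_extension_chains:
  assumes "c \<in> chains R Y n" and "\<And>s. s \<in> simplices Y n \<Longrightarrow> f s \<in> chains R Z m"
  shows "linear_extension f c \<in> chains R Z m"
  unfolding linear_extension_def
  using assms by (intro sum_chains scale_chains) (auto simp: chains_def)

end

lemma chains_mono: "simplices Y n \<subseteq> simplices Z n \<Longrightarrow> chains R Y n \<subseteq> chains R Z n"
  by (auto simp: chains_def)

definition simplex_boundary :: "'s sset \<Rightarrow> nat \<Rightarrow> 's \<Rightarrow> ('s \<Rightarrow>\<^sub>0 'r::comm_ring_1)" where
  "simplex_boundary Y n s =
     (if n = 0 then 0 else \<Sum>i\<le>n. Poly_Mapping.single (face Y n i s) ((-1) ^ i))"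

lemma boundary_eq: "boundary Y n = linear_extension (simplex_boundary Y n)"
  by (simp add: fun_eq_iff boundary_def linear_extension_def simplex_boundary_def scale_sum mult.commute)

lemma monotone_coface: "i \<le> Suc n \<Longrightarrow> monotone_map n (Suc n) (coface i)"
  by (auto simp: monotone_map_def coface_def mono_on_def)

lemma face_simplices:
  assumes "simplicial_set Y" "s \<in> simplices Y (Suc n)" "i \<le> Suc n"
  shows "face Y (Suc n) i s \<in> simplices Y n"
  using assms monotone_coface[of i n] unfolding simplicial_set_def face_def by auto

text \<open>The identity between composites of cofaces, read contravariantly. As
  \<open>j < i\<close>, the truncated \<open>i - 1\<close> is a true predecessor.\<close>

lemma face_face:
  assumes Y: "simplicial_set Y" and s: "s \<in> simplices Y (Suc (Suc n))" and ij: "j < i" "i \<le> Suc (Suc n)"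
  shows "face Y (Suc n) j (face Y (Suc (Suc n)) i s) =
    face Y (Suc n) (i - 1) (face Y (Suc (Suc n)) j s)"
proof -
  have m: "monotone_map (Suc n) (Suc (Suc n)) (coface i)" "monotone_map n (Suc n) (coface j)"
     "monotone_map (Suc n) (Suc (Suc n)) (coface j)" "monotone_map n (Suc n) (coface (i - 1))"
    using ij by (auto intro: monotone_coface)
  have "coface i \<circ> coface j = coface j \<circ> coface (i - 1)"
    using ij by (auto simp: coface_def fun_eq_iff)
  moreover have "smap Y k l (\<theta> \<circ> \<eta>) s = smap Y h l \<eta> (smap Y k h \<theta> s)"
    if "monotone_map h k \<theta>" "monotone_map l h \<eta>" "s \<in> simplices Y k" for k h l \<theta> \<eta> s
    using Y that unfolding simplicial_set_def by blast
  ultimately show ?thesis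
    using m s unfolding face_def by (metis diff_Suc_1)
qed

text \<open>The double sum over pairs of faces splits along \<open>j < i\<close> and
  \<open>i \<le> j\<close>, and the simplicial identity cancels one half against the other.\<close>

lemma boundary_simplex_boundary:
  assumes Y: "simplicial_set Y" and s: "s \<in> simplices Y (Suc n)"
  shows "boundary Y n (simplex_boundary Y (Suc n) s) = (0 :: 's \<Rightarrow>\<^sub>0 'r::comm_ring_1)"
proof (cases n)
  case 0
  then show ?thesis by (simp add: boundary_def)
next
  case (Suc m)
  define t where "t = (\<lambda>(i, j). Poly_Mapping.single (face Y (Suc m) j (face Y (Suc (Suc m)) i s))
    ((-1) ^ (i + j)) :: 's \<Rightarrow>\<^sub>0 'r)"
  define A where "A = {(i, j). j < i \<and> i \<le> Suc (Suc m)}"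
  define B where "B = {(i, j). i \<le> j \<and> j \<le> Suc m}"
  have fin: "finite A" "finite B"
    by (rule finite_subset[of _ "{..Suc (Suc m)} \<times> {..Suc (Suc m)}"]; auto simp: A_def B_def)+
  have AB: "{..Suc (Suc m)} \<times> {..Suc m} = A \<union> B"
  proof (rule Set.set_eqI)
    fix x :: "nat \<times> nat"
    show "x \<in> {..Suc (Suc m)} \<times> {..Suc m} \<longleftrightarrow> x \<in> A \<union> B"
      by (cases x) (simp add: A_def B_def, linarith)
  qed
  have "boundary Y n (simplex_boundary Y (Suc n) s) = (\<Sum>i\<le>Suc (Suc m). \<Sum>j\<le>Suc m. t (i, j))"
    by (simp add: boundary_eq simplex_boundary_def Suc linear_extension_sum scale_sum t_def
        power_add mult.commute del: sum.atMost_Suc)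
  also have "\<dots> = sum t ({..Suc (Suc m)} \<times> {..Suc m})"
    by (simp add: sum.cartesian_product del: sum.atMost_Suc)
  also have "\<dots> = sum t (A \<union> B)"
    by (simp only: AB)
  also have "\<dots> = sum t A + sum t B"
    by (rule sum.union_disjoint[OF fin]) (auto simp: A_def B_def)
  \<comment> \<open>The pair \<open>(i, j)\<close> is matched with \<open>(j, i - 1)\<close>. This
    lowers the exponent \<open>i + j\<close> by one and so flips the sign.\<close>
  also have "sum t A = (\<Sum>x\<in>B. - t x)"
  proof (rule sum.reindex_bij_witness[of _ "\<lambda>(i, j). (Suc j, i)" "\<lambda>(i, j). (j, i - 1)"])
    fix x assume "x \<in> A"
    then obtain i j where x: "x = (i, j)" "j < i" "i \<le> Suc (Suc m)"
      by (auto simp: A_def)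
    then obtain k where k: "i = Suc k" by (cases i) auto
    have "face Y (Suc m) j (face Y (Suc (Suc m)) i s) =
        face Y (Suc m) (i - 1) (face Y (Suc (Suc m)) j s)"
      using face_face[OF Y] s x Suc by simp
    then show "- t (case x of (i, j) \<Rightarrow> (j, i - 1)) = t x"
      by (simp add: t_def x(1) k power_add mult.commute single_uminus[symmetric])
  qed (auto simp: A_def B_def)
  finally show ?thesis by (simp add: sum_negf)
qed

lemma boundary_boundary:
  assumes Y: "simplicial_set Y" and c: "Poly_Mapping.keys c \<subseteq> simplices Y (Suc n)"
  shows "boundary Y n (boundary Y (Suc n) c) = 0"
proof -
  have "boundary Y n (boundary Y (Suc n) c) =
      linear_extension (\<lambda>s. boundary Y n (simplex_boundary Y (Suc n) s)) c"
    unfolding boundary_eq by (rule linear_extension_linear_extension)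
  also have "\<dots> = linear_extension (\<lambda>s. 0) c"
    using c by (intro linear_extension_cong boundary_simplex_boundary Y) auto
  finally show ?thesis by simp
qed

lemma (in coefficient_ring) simplex_boundary_chains:
  assumes "simplicial_set Y" "s \<in> simplices Y (Suc n)"
  shows "simplex_boundary Y (Suc n) s \<in> chains R Y n"
  unfolding simplex_boundary_def
  using assms by (auto intro!: sum_chains single_chains face_simplices sign_mem simp del: sum.atMost_Suc)

lemma (in coefficient_ring) boundary_chains:
  assumes "simplicial_set Y" "c \<in> chains R Y (Suc n)"
  shows "boundary Y (Suc n) c \<in> chains R Y n"
  unfolding boundary_eq using assms
  by (blast intro: linear_extension_chains simplex_boundary_chains)

lemma boundary_push:
  assumes "\<And>s i. s \<in> Poly_Mapping.keys c \<Longrightarrow> i \<le> Suc n \<Longrightarrow> face Z (Suc n) i (f s) = g (face Y (Suc n) i s)"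
  shows "boundary Z (Suc n) (push f c) = push g (boundary Y (Suc n) c)"
  unfolding boundary_eq linear_extension_linear_extension
  using assms
  by (intro linear_extension_cong)
    (simp add: simplex_boundary_def linear_extension_sum del: sum.atMost_Suc)

section \<open>Acyclicity\<close>

text \<open>With values in the chains on one point instead of the ring, the augmentation is itself a
  \<open>push\<close>, and its target contains the degree zero cycles of
  \<open>point_sset\<close>.\<close>

abbreviation augmentation :: "('s \<Rightarrow>\<^sub>0 'r) \<Rightarrow> (unit \<Rightarrow>\<^sub>0 'r::comm_ring_1)" where
  "augmentation \<equiv> push (\<lambda>s. ())"

definition reduced_cycles :: "'r::comm_ring_1 set \<Rightarrow> 's sset \<Rightarrow> nat \<Rightarrow> ('s \<Rightarrow>\<^sub>0 'r) set" where
  "reduced_cycles R Y n =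
     {c \<in> chains R Y n. if n = 0 then augmentation c = 0 else boundary Y n c = 0}"

text \<open>The demand for a vertex excludes the empty space, whose reduced cycles in degrees
  \<open>n \<ge> 0\<close> are all zero.\<close>

definition acyclic_over :: "'r::comm_ring_1 set \<Rightarrow> 's sset \<Rightarrow> bool" where
  "acyclic_over R Y \<longleftrightarrow> simplices Y 0 \<noteq> {} \<and>
     (\<forall>n. reduced_cycles R Y n \<subseteq> boundary Y (Suc n) ` chains R Y (Suc n))"

lemma augmentation_simplex_boundary [simp]: "augmentation (simplex_boundary Y (Suc 0) s) = 0"
  by (simp add: simplex_boundary_def linear_extension_add linear_extension_diff flip: single_add)

lemma augmentation_boundary [simp]: "augmentation (boundary Y (Suc 0) c) = 0"
  by (simp add: boundary_eq linear_extension_linear_extension)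

lemma (in coefficient_ring) boundary_reduced_cycles:
  assumes Y: "simplicial_set Y" and c: "c \<in> chains R Y (Suc n)"
  shows "boundary Y (Suc n) c \<in> reduced_cycles R Y n"
  using boundary_chains[OF Y c] boundary_boundary[OF Y, of c n] c
  by (auto simp: reduced_cycles_def chains_def)

text \<open>\<open>e n s\<close> is the cone on \<open>s\<close>, with the apex \<open>x\<close>
  added as vertex 0: deleting the apex returns \<open>s\<close>, and every other face is the cone on
  a face.\<close>

definition extra_degeneracy :: "'s sset \<Rightarrow> 's \<Rightarrow> (nat \<Rightarrow> 's \<Rightarrow> 's) \<Rightarrow> bool" where
  "extra_degeneracy Y x e \<longleftrightarrow> x \<in> simplices Y 0 \<and>
     (\<forall>n. \<forall>s\<in>simplices Y n. e n s \<in> simplices Y (Suc n) \<and> face Y (Suc n) 0 (e n s) = s) \<and>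
     (\<forall>s\<in>simplices Y 0. face Y (Suc 0) (Suc 0) (e 0 s) = x) \<and>
     (\<forall>n. \<forall>s\<in>simplices Y (Suc n). \<forall>i\<le>Suc n.
        face Y (Suc (Suc n)) (Suc i) (e (Suc n) s) = e n (face Y (Suc n) i s))"

text \<open>Coning is a contracting homotopy: \<open>\<partial> e = id - e \<partial>\<close> in
  positive degrees and \<open>\<partial> e s = s - x\<close> on vertices. On reduced cycles the
  correction term vanishes.\<close>

lemma (in coefficient_ring) acyclic_over_extra_degeneracy:
  assumes e: "extra_degeneracy Y x e"
  shows "acyclic_over R Y"
  unfolding acyclic_over_def
proof (intro conjI allI subsetI)
  show "simplices Y 0 \<noteq> {}"
    using e by (auto simp: extra_degeneracy_def)
next
  fix n c assume c: "c \<in> reduced_cycles R Y n"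
  then have cc: "c \<in> chains R Y n" by (simp add: reduced_cycles_def)
  have b: "boundary Y (Suc n) (push (e n) c) =
      linear_extension (\<lambda>s. simplex_boundary Y (Suc n) (e n s)) c"
    by (simp add: boundary_eq linear_extension_linear_extension)
  have "boundary Y (Suc n) (push (e n) c) = c"
  proof (cases n)
    case 0
    have "boundary Y (Suc n) (push (e n) c) =
        linear_extension (\<lambda>s. Poly_Mapping.single s 1 - Poly_Mapping.single x 1) c"
      unfolding b
      using cc e 0 by (intro linear_extension_cong)
        (auto simp: simplex_boundary_def extra_degeneracy_def chains_def single_uminus)
    also have "\<dots> = c - push (\<lambda>s. x) c"
      by (simp add: linear_extension_fun_diff)
    \<comment> \<open>A constant map of simplices factors through a point, so its value on
      \<open>c\<close> is governed by the augmentation.\<close>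
    also have "push (\<lambda>s. x) c = push (\<lambda>u. x) (augmentation c)"
      by (simp add: linear_extension_linear_extension)
    also have "\<dots> = 0"
      using c 0 by (simp add: reduced_cycles_def)
    finally show ?thesis by simp
  next
    case (Suc m)
    have "boundary Y (Suc n) (push (e n) c) =
        linear_extension (\<lambda>s. Poly_Mapping.single s 1 - push (e m) (simplex_boundary Y n s)) c"
      unfolding b
    proof (intro linear_extension_cong)
      fix s assume "s \<in> Poly_Mapping.keys c"
      then have s: "s \<in> simplices Y (Suc m)" using cc Suc by (auto simp: chains_def)
      \<comment> \<open>Face 0 is split off; the shift of the remaining indices by one is the source
        of the minus sign.\<close>
      have "simplex_boundary Y (Suc n) (e n s) = Poly_Mapping.single s 1 +
          (\<Sum>i\<le>Suc m. Poly_Mapping.single (face Y (Suc n) (Suc i) (e n s)) ((-1) ^ Suc i))"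
        using e s Suc unfolding simplex_boundary_def
        by (subst sum.atMost_Suc_shift) (simp add: extra_degeneracy_def del: sum.atMost_Suc)
      also have "\<dots> = Poly_Mapping.single s 1 - push (e m) (simplex_boundary Y n s)"
        using e s Suc
        by (simp add: simplex_boundary_def extra_degeneracy_def linear_extension_sum single_uminus
            sum_negf del: sum.atMost_Suc)
      finally show "simplex_boundary Y (Suc n) (e n s) =
          Poly_Mapping.single s 1 - push (e m) (simplex_boundary Y n s)" .
    qed
    also have "\<dots> = c - push (e m) (boundary Y n c)"
      by (simp add: linear_extension_fun_diff boundary_eq linear_extension_linear_extension)
    finally show ?thesis using c Suc by (simp add: reduced_cycles_def)
  qed
  moreover have "push (e n) c \<in> chains R Y (Suc n)"
    using cc e by (auto simp: extra_degeneracy_def intro!: linear_extension_chains single_chains)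
  ultimately show "c \<in> boundary Y (Suc n) ` chains R Y (Suc n)"
    by (metis imageI)
qed

section \<open>Localised integers and the homology of acyclic spaces\<close>

lemma coefficient_ring_Z_localized:
  assumes "Factorial_Ring.prime p"
  shows "coefficient_ring (Z_localized p)"
proof -
  have pr: "Factorial_Ring.prime (int p)" using assms by simp
  have mem: "x \<in> Z_localized p" if "x = of_int a / of_int b" "\<not> int p dvd b" for x a b
    using that unfolding Z_localized_def by blast
  show ?thesis
  proof
    have "\<not> int p dvd 1" using pr not_prime_unit by blast
    then show "0 \<in> Z_localized p" "1 \<in> Z_localized p"
      by (auto intro: mem[of _ 0 1] mem[of _ 1 1])
  next
    fix x y assume "x \<in> Z_localized p" "y \<in> Z_localized p"
    then obtain a b c d where h: "x = of_int a / of_int b" "\<not> int p dvd b"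
      "y = of_int c / of_int d" "\<not> int p dvd d"
      unfolding Z_localized_def by blast
    then have nz: "b \<noteq> 0" "d \<noteq> 0" by auto
    have bd: "\<not> int p dvd b * d" using h pr by (simp add: prime_dvd_mult_iff)
    show "x + y \<in> Z_localized p"
      by (rule mem[of _ "a * d + c * b" "b * d"]) (use h nz bd in \<open>auto simp: field_simps\<close>)
    show "x * y \<in> Z_localized p"
      by (rule mem[of _ "a * c" "b * d"]) (use h bd in auto)
  next
    fix x assume "x \<in> Z_localized p"
    then obtain a b where h: "x = of_int a / of_int b" "\<not> int p dvd b"
      unfolding Z_localized_def by blast
    then show "- x \<in> Z_localized p" by (intro mem[of _ "- a" b]) auto
  qed
qed

lemma (in coefficient_ring) group_cycle_group: "group (cycle_group R Y n)"
proof (rule groupI)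
  fix c assume "c \<in> carrier (cycle_group R Y n)"
  then have "- c \<in> carrier (cycle_group R Y n)" "- c + c = 0"
    using linear_extension_diff[of "simplex_boundary Y n" 0 c]
    by (auto simp: cycle_group_def boundary_eq uminus_chains)
  then show "\<exists>d\<in>carrier (cycle_group R Y n). d \<otimes>\<^bsub>cycle_group R Y n\<^esub> c = \<one>\<^bsub>cycle_group R Y n\<^esub>"
    by (auto simp: cycle_group_def)
qed (auto simp: cycle_group_def boundary_eq linear_extension_add add_chains add.assoc)

lemma extra_degeneracy_point: "extra_degeneracy point_sset () (\<lambda>n s. ())"
  by (simp add: extra_degeneracy_def point_sset_def)

lemma simplicial_set_point: "simplicial_set point_sset"
  by (simp add: simplicial_set_def point_sset_def)

text \<open>First isomorphism theorem for the augmentation in degree 0 and the zero map elsewhere: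
  in both cases the kernel is the group of reduced cycles, which are the boundaries. The target is
  the same for all \<open>Y\<close>, so two acyclic spaces can be compared through it; the group
  claim allows one of the isomorphisms to be inverted.\<close>

lemma homology_acyclic:
  fixes R :: "'r::comm_ring_1 set" and Y :: "'s sset"
  assumes R: "coefficient_ring R" and Y: "simplicial_set Y" and ac: "acyclic_over R Y"
  shows "group (homology_with R Y n)"
    and "homology_with R Y n \<cong>
      (if n = 0 then cycle_group R point_sset 0 else \<lparr>carrier = {0}, monoid.mult = (+), one = 0\<rparr>)"
      (is "_ \<cong> ?T")
proof -
  interpret coefficient_ring R by (rule R)
  define h where "h = (\<lambda>c :: 's \<Rightarrow>\<^sub>0 'r. if n = 0 then augmentation c else 0)"
  have bd: "boundary Y (Suc n) ` chains R Y (Suc n) = reduced_cycles R Y n"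
    using ac boundary_reduced_cycles[OF Y, of _ n] by (auto simp: acyclic_over_def)
  have T: "group ?T"
    using group_cycle_group[of point_sset 0]
    by (auto intro!: groupI)
  have hom: "h \<in> hom (cycle_group R Y n) ?T"
    by (auto simp: hom_def h_def cycle_group_def linear_extension_add boundary_def point_sset_def
        intro!: linear_extension_chains single_chains)
  interpret group_hom "cycle_group R Y n" ?T h
    using group_cycle_group T hom by (simp add: group_hom_def group_hom_axioms_def)
  have ker: "kernel (cycle_group R Y n) ?T h = boundary Y (Suc n) ` chains R Y (Suc n)"
    unfolding bd
    by (auto simp: kernel_def reduced_cycles_def cycle_group_def h_def boundary_def)
  have "carrier ?T \<subseteq> h ` carrier (cycle_group R Y n)"
  proof (cases "n = 0")
    case True
    \<comment> \<open>A vertex splits the augmentation.\<close>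
    obtain x where x: "x \<in> simplices Y 0"
      using ac by (auto simp: acyclic_over_def)
    show ?thesis
    proof
      fix c assume c: "c \<in> carrier ?T"
      have "push (\<lambda>u. x) c \<in> carrier (cycle_group R Y n)"
        using c x True
        by (auto simp: cycle_group_def boundary_def intro!: linear_extension_chains single_chains)
      moreover have "h (push (\<lambda>u. x) c) = c"
        using True linear_extension_basis[of c] by (simp add: h_def linear_extension_linear_extension)
      ultimately show "c \<in> h ` carrier (cycle_group R Y n)" by (metis imageI)
    qed
  next
    case False
    then have "h 0 = 0" "0 \<in> carrier (cycle_group R Y n)"
      using one_closed by (simp_all add: h_def cycle_group_def boundary_eq)
    then show ?thesis using False by force
  qed
  then have surj: "h ` carrier (cycle_group R Y n) = carrier ?T"
    using hom_closed by blast
  show "homology_with R Y n \<cong> ?T"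
    using FactGroup_iso_set[OF surj] unfolding ker homology_with_def is_iso_def by blast
  show "group (homology_with R Y n)"
    using normal.factorgroup_is_group[OF normal_kernel] unfolding ker homology_with_def .
qed

lemma Zp_acyclicI:
  assumes p: "Factorial_Ring.prime p" and Y: "simplicial_set Y"
    and ac: "acyclic_over (Z_localized p) Y"
  shows "Zp_acyclic p Y"
proof -
  have R: "coefficient_ring (Z_localized p)"
    by (rule coefficient_ring_Z_localized[OF p])
  have pt: "acyclic_over (Z_localized p) point_sset"
    by (rule coefficient_ring.acyclic_over_extra_degeneracy[OF R extra_degeneracy_point])
  show ?thesis
    unfolding Zp_acyclic_def
    using homology_acyclic(2)[OF R Y ac] homology_acyclic[OF R simplicial_set_point pt]
    by (metis group.iso_sym iso_trans)
qed

section \<open>Simplicial group actions\<close>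

lemma face_fixed_points [simp]: "face (fixed_points Y \<phi> P) = face Y"
  by (simp add: face_def fixed_points_def fun_eq_iff)

lemma boundary_fixed_points [simp]: "boundary (fixed_points Y \<phi> P) = boundary Y"
  by (simp add: fun_eq_iff boundary_def)

lemma simplex_boundary_fixed_points [simp]:
  "simplex_boundary (fixed_points Y \<phi> P) = simplex_boundary Y"
  by (simp add: fun_eq_iff simplex_boundary_def)

lemma simplices_fixed_points [simp]:
  "simplices (fixed_points Y \<phi> P) n = {s \<in> simplices Y n. \<forall>g\<in>P. \<phi> n g s = s}"
  by (simp add: fixed_points_def)

lemma sum_const_scale: "(\<Sum>i\<in>I. c) = scale (of_nat (card I)) c"
proof (cases "finite I")
  case True
  then show ?thesis
    by (induction I) (auto intro!: poly_mapping_eqI simp: lookup_add distrib_right)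
qed (auto intro!: poly_mapping_eqI)

text \<open>Invariance under left translation by \<open>S\<close> makes \<open>f\<close> constant on
  right cosets. The constant inner sum is kept as a sum because the values form only a monoid; for
  chains it becomes the factor \<open>card S\<close>.\<close>

lemma (in group) sum_rcosets:
  fixes f :: "'a \<Rightarrow> 'c::comm_monoid_add"
  assumes fin: "finite (carrier G)" and S: "subgroup S G"
    and f: "\<And>s g. s \<in> S \<Longrightarrow> g \<in> carrier G \<Longrightarrow> f (s \<otimes> g) = f g"
  shows "(\<Sum>g\<in>carrier G. f g) = (\<Sum>C\<in>rcosets S. \<Sum>s\<in>S. f (SOME g. g \<in> C))"
proof -
  have "(\<Sum>g\<in>carrier G. f g) = (\<Sum>g\<in>\<Union>(rcosets S). f g)"
    by (simp add: rcosets_part_G[OF S])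
  also have "\<dots> = (\<Sum>C\<in>rcosets S. \<Sum>g\<in>C. f g)"
  proof -
    have "\<forall>C\<in>rcosets S. finite C"
      using rcosets_part_G[OF S] fin by (metis Union_upper finite_subset)
    moreover have "\<forall>C\<in>rcosets S. \<forall>D\<in>rcosets S. C \<noteq> D \<longrightarrow> C \<inter> D = {}"
      using rcos_disjoint[OF S] by (auto simp: pairwise_def disjnt_def)
    ultimately show ?thesis by (simp add: sum.Union_disjoint)
  qed
  also have "\<dots> = (\<Sum>C\<in>rcosets S. \<Sum>s\<in>S. f (SOME g. g \<in> C))"
  proof (rule sum.cong[OF refl])
    fix C assume "C \<in> rcosets S"
    then obtain a where a: "a \<in> carrier G" "C = S #> a" by (auto simp: RCOSETS_def)
    have const: "f g = f a" if "g \<in> C" for g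
      using that a f by (auto simp: r_coset_def)
    have "a \<in> C" using a S rcos_self by simp
    then have rep: "f (SOME g. g \<in> C) = f a" by (metis const someI)
    have inj: "inj_on (\<lambda>s. s \<otimes> a) S"
      using a S by (meson inj_onI r_cancel subgroup.mem_carrier)
    have "C = (\<lambda>s. s \<otimes> a) ` S" using a by (auto simp: r_coset_def)
    then have "(\<Sum>g\<in>C. f g) = (\<Sum>s\<in>S. f a)"
      using a f by (simp add: sum.reindex[OF inj])
    then show "(\<Sum>g\<in>C. f g) = (\<Sum>s\<in>S. f (SOME g. g \<in> C))"
      by (simp only: rep)
  qed
  finally show ?thesis .
qed

text \<open>The laws are imposed on simplices only: \<open>E_action\<close> restricts the objects to
  \<open>{..n}\<close>, so even the identity of the group may change a pair that is not a
  simplex.\<close>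

locale simplicial_action = group G for G :: "('a, 'b) monoid_scheme" (structure) +
  fixes Y :: "'s sset" and \<phi> :: "nat \<Rightarrow> 'a \<Rightarrow> 's \<Rightarrow> 's"
  assumes simplicial: "simplicial_set Y"
    and act_closed [simp]: "g \<in> carrier G \<Longrightarrow> s \<in> simplices Y n \<Longrightarrow> \<phi> n g s \<in> simplices Y n"
    and act_one [simp]: "s \<in> simplices Y n \<Longrightarrow> \<phi> n \<one> s = s"
    and act_mult: "g \<in> carrier G \<Longrightarrow> h \<in> carrier G \<Longrightarrow> s \<in> simplices Y n \<Longrightarrow>
      \<phi> n (g \<otimes> h) s = \<phi> n g (\<phi> n h s)"
    and act_smap: "monotone_map m n \<theta> \<Longrightarrow> g \<in> carrier G \<Longrightarrow> s \<in> simplices Y n \<Longrightarrow>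
      smap Y n m \<theta> (\<phi> n g s) = \<phi> m g (smap Y n m \<theta> s)"
begin

lemma face_act:
  "g \<in> carrier G \<Longrightarrow> s \<in> simplices Y (Suc n) \<Longrightarrow> i \<le> Suc n \<Longrightarrow>
    face Y (Suc n) i (\<phi> (Suc n) g s) = \<phi> n g (face Y (Suc n) i s)"
  by (simp add: face_def act_smap monotone_coface)

lemma act_inv: "g \<in> carrier G \<Longrightarrow> s \<in> simplices Y n \<Longrightarrow> \<phi> n (inv g) (\<phi> n g s) = s"
  by (simp flip: act_mult)

lemma simplicial_fixed_points: "P \<subseteq> carrier G \<Longrightarrow> simplicial_set (fixed_points Y \<phi> P)"
  using simplicial act_smap by (intro simplicial_set_fixed_points) auto

lemma simplex_boundary_act:
  "g \<in> carrier G \<Longrightarrow> s \<in> simplices Y (Suc n) \<Longrightarrow>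
    simplex_boundary Y (Suc n) (\<phi> (Suc n) g s) = push (\<phi> n g) (simplex_boundary Y (Suc n) s)"
  by (simp add: simplex_boundary_def face_act linear_extension_sum del: sum.atMost_Suc)

lemma push_act_act:
  assumes "g \<in> carrier G" "h \<in> carrier G" "Poly_Mapping.keys c \<subseteq> simplices Y n"
  shows "push (\<phi> n g) (push (\<phi> n h) c) = push (\<phi> n (g \<otimes> h)) c"
  using assms unfolding linear_extension_linear_extension
  by (intro linear_extension_cong) (auto simp: act_mult)

lemma subgroup_stabilizer:
  assumes "s \<in> simplices Y n"
  shows "subgroup (stabilizer G (\<phi> n) s) G"
proof (rule subgroupI)
  show "stabilizer G (\<phi> n) s \<noteq> {}" using assms by (auto simp: stabilizer_def)
  show "inv g \<in> stabilizer G (\<phi> n) s" if "g \<in> stabilizer G (\<phi> n) s" for g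
    using that act_inv[of g s n] assms by (auto simp: stabilizer_def)
qed (use assms in \<open>auto simp: stabilizer_def act_mult\<close>)

lemma orbit_act:
  assumes "g \<in> carrier G" "s \<in> simplices Y n"
  shows "orbit G (\<phi> n) (\<phi> n g s) = orbit G (\<phi> n) s"
proof -
  have "\<phi> n h (\<phi> n g s) \<in> orbit G (\<phi> n) s" if "h \<in> carrier G" for h
    using that assms by (auto simp: orbit_def simp flip: act_mult)
  moreover have "\<phi> n h s \<in> orbit G (\<phi> n) (\<phi> n g s)" if "h \<in> carrier G" for h
  proof -
    have "\<phi> n h s = \<phi> n (h \<otimes> inv g) (\<phi> n g s)"
      using that assms by (simp add: act_mult act_inv)
    then show ?thesis using that assms by (auto simp: orbit_def)
  qed
  ultimately show ?thesis by (auto simp: orbit_def)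
qed

text \<open>Transport of a chain along an orbit does not depend on the transporting element:
  \<open>g\<close> and \<open>h\<close> differ by an element of the stabiliser of \<open>s\<close>,
  and this fixes each simplex in the support of \<open>c\<close>.\<close>

lemma push_act_cong:
  assumes g: "g \<in> carrier G" and h: "h \<in> carrier G" and s: "s \<in> simplices Y m"
    and eq: "\<phi> m g s = \<phi> m h s"
    and c: "Poly_Mapping.keys c \<subseteq> simplices (fixed_points Y \<phi> (stabilizer G (\<phi> m) s)) n"
  shows "push (\<phi> n g) c = push (\<phi> n h) c"
proof (rule linear_extension_cong)
  fix t assume "t \<in> Poly_Mapping.keys c"
  then have t: "t \<in> simplices Y n" "\<And>k. k \<in> stabilizer G (\<phi> m) s \<Longrightarrow> \<phi> n k t = t"
    using c by auto
  have "inv h \<otimes> g \<in> stabilizer G (\<phi> m) s"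
    using g h s eq by (simp add: stabilizer_def act_mult act_inv)
  then have "\<phi> n h (\<phi> n (inv h \<otimes> g) t) = \<phi> n h t" using t by simp
  moreover have "\<phi> n h (\<phi> n (inv h \<otimes> g) t) = \<phi> n g t"
    using g h t by (simp add: m_assoc[symmetric] flip: act_mult)
  ultimately show "Poly_Mapping.single (\<phi> n g t) 1 = Poly_Mapping.single (\<phi> n h t) 1" by simp
qed

text \<open>
  A filling is chosen on one simplex of each orbit, inside the fixed points of its stabiliser, and
  carried along the orbit by the action.
\<close>

lemma equivariant_filling:
  fixes R :: "'r::comm_ring_1 set"
  assumes R: "coefficient_ring R"
    and ac: "\<And>Q. subgroup Q G \<Longrightarrow> acyclic_over R (fixed_points Y \<phi> Q)"
    and k: "\<And>s. s \<in> simplices Y n \<Longrightarrow>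
      Poly_Mapping.single s 1 - k s \<in> reduced_cycles R (fixed_points Y \<phi> (stabilizer G (\<phi> n) s)) n"
    and equiv: "\<And>g s. g \<in> carrier G \<Longrightarrow> s \<in> simplices Y n \<Longrightarrow> k (\<phi> n g s) = push (\<phi> n g) (k s)"
  obtains h where
    "\<And>s. s \<in> simplices Y n \<Longrightarrow> h s \<in> chains R (fixed_points Y \<phi> (stabilizer G (\<phi> n) s)) (Suc n)"
    "\<And>g s. g \<in> carrier G \<Longrightarrow> s \<in> simplices Y n \<Longrightarrow> h (\<phi> n g s) = push (\<phi> (Suc n) g) (h s)"
    "\<And>s. s \<in> simplices Y n \<Longrightarrow> boundary Y (Suc n) (h s) = Poly_Mapping.single s 1 - k s"
proof -
  interpret coefficient_ring R by (rule R)
  let ?F = "\<lambda>s. fixed_points Y \<phi> (stabilizer G (\<phi> n) s)"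
  have "\<exists>c \<in> chains R (?F s) (Suc n). boundary Y (Suc n) c = Poly_Mapping.single s 1 - k s"
    if "s \<in> simplices Y n" for s
  proof -
    have "Poly_Mapping.single s 1 - k s \<in> boundary (?F s) (Suc n) ` chains R (?F s) (Suc n)"
      using k[OF that] ac[OF subgroup_stabilizer[OF that]] unfolding acyclic_over_def by blast
    then show ?thesis unfolding boundary_fixed_points by force
  qed
  then obtain f where f: "\<And>s. s \<in> simplices Y n \<Longrightarrow> f s \<in> chains R (?F s) (Suc n)"
    "\<And>s. s \<in> simplices Y n \<Longrightarrow> boundary Y (Suc n) (f s) = Poly_Mapping.single s 1 - k s"
    by metis
  \<comment> \<open>The choice depends only on the orbit as a set, so all simplices of an orbit
    share it.\<close>
  define rep where "rep s = (SOME t. t \<in> orbit G (\<phi> n) s)" for s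
  define tr where "tr s = (SOME g. g \<in> carrier G \<and> \<phi> n g (rep s) = s)" for s
  define h where "h s = push (\<phi> (Suc n) (tr s)) (f (rep s))" for s
  have "s \<in> orbit G (\<phi> n) s" if "s \<in> simplices Y n" for s
    using act_one[OF that] by (force simp: orbit_def)
  then have "rep s \<in> orbit G (\<phi> n) s" if "s \<in> simplices Y n" for s
    using that unfolding rep_def by (metis someI)
  then obtain q where q: "\<And>s. s \<in> simplices Y n \<Longrightarrow> q s \<in> carrier G"
    "\<And>s. s \<in> simplices Y n \<Longrightarrow> rep s = \<phi> n (q s) s"
    unfolding orbit_def by (auto; metis)
  have rep: "rep s \<in> simplices Y n" if "s \<in> simplices Y n" for s
    using q[OF that] that by simp
  have "tr s \<in> carrier G \<and> \<phi> n (tr s) (rep s) = s" if "s \<in> simplices Y n" for s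
    unfolding tr_def
    by (rule someI[of _ "inv (q s)"]) (use q[OF that] that in \<open>simp add: act_inv\<close>)
  then have tr: "tr s \<in> carrier G" "\<phi> n (tr s) (rep s) = s" if "s \<in> simplices Y n" for s
    using that by auto
  have repg: "rep (\<phi> n g s) = rep s" if "g \<in> carrier G" "s \<in> simplices Y n" for g s
    using orbit_act[OF that] by (simp add: rep_def)
  have kf: "Poly_Mapping.keys (f (rep s)) \<subseteq> simplices (?F (rep s)) (Suc n)" if "s \<in> simplices Y n" for s
    using f(1)[OF rep[OF that]] by (simp add: chains_def)
  show thesis
  proof
    fix g s assume gs: "g \<in> carrier G" "s \<in> simplices Y n"
    \<comment> \<open>The elements \<open>tr (\<phi> n g s)\<close> and
      \<open>g \<otimes> tr s\<close> may differ, but both carry \<open>rep s\<close> to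
      \<open>\<phi> n g s\<close>.\<close>
    have "push (\<phi> (Suc n) (tr (\<phi> n g s))) (f (rep s)) = push (\<phi> (Suc n) (g \<otimes> tr s)) (f (rep s))"
    proof (rule push_act_cong[where s = "rep s" and m = n])
      show "\<phi> n (tr (\<phi> n g s)) (rep s) = \<phi> n (g \<otimes> tr s) (rep s)"
        using gs tr[of "\<phi> n g s"] tr[of s] rep by (simp add: repg act_mult)
    qed (use gs tr rep kf in auto)
    also have "\<dots> = push (\<phi> (Suc n) g) (h s)"
      using gs tr kf[of s] unfolding h_def by (intro push_act_act[symmetric]) auto
    finally show "h (\<phi> n g s) = push (\<phi> (Suc n) g) (h s)"
      using gs by (simp add: h_def[of "\<phi> n g s"] repg)
  next
    fix s assume s: "s \<in> simplices Y n"
    have "boundary Y (Suc n) (h s) = push (\<phi> n (tr s)) (boundary Y (Suc n) (f (rep s)))"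
      unfolding h_def using s kf[of s] tr by (intro boundary_push face_act) auto
    also have "\<dots> = Poly_Mapping.single s 1 - k s"
      using s f(2)[OF rep[OF s]] tr[OF s] equiv[of "tr s" "rep s"] rep[OF s]
      by (simp add: linear_extension_diff)
    finally show "boundary Y (Suc n) (h s) = Poly_Mapping.single s 1 - k s" .
    show "h s \<in> chains R (?F s) (Suc n)"
      unfolding h_def
    proof (rule linear_extension_chains[OF f(1)[OF rep[OF s]]], rule single_chains)
      fix t assume "t \<in> simplices (?F (rep s)) (Suc n)"
      then have t: "t \<in> simplices Y (Suc n)"
        "\<And>k. k \<in> stabilizer G (\<phi> n) (rep s) \<Longrightarrow> \<phi> (Suc n) k t = t" by auto
      have "\<phi> (Suc n) k (\<phi> (Suc n) (tr s) t) = \<phi> (Suc n) (tr s) t"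
        if k: "k \<in> carrier G" "\<phi> n k s = s" for k
      proof -
        \<comment> \<open>Conjugation by \<open>tr s\<close> relates the stabilisers of
          \<open>s\<close> and of \<open>rep s\<close>.\<close>
        have "inv (tr s) \<otimes> (k \<otimes> tr s) \<in> stabilizer G (\<phi> n) (rep s)"
          using k tr[OF s] rep[OF s] act_inv[OF tr(1)[OF s] rep[OF s]]
          by (simp add: stabilizer_def act_mult)
        then have "\<phi> (Suc n) (tr s) (\<phi> (Suc n) (inv (tr s) \<otimes> (k \<otimes> tr s)) t) = \<phi> (Suc n) (tr s) t"
          using t by simp
        moreover have "\<phi> (Suc n) (tr s) (\<phi> (Suc n) (inv (tr s) \<otimes> (k \<otimes> tr s)) t) =
            \<phi> (Suc n) k (\<phi> (Suc n) (tr s) t)"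
          using k tr[OF s] t by (simp add: m_assoc[symmetric] flip: act_mult)
        ultimately show ?thesis by simp
      qed
      then show "\<phi> (Suc n) (tr s) t \<in> simplices (?F s) (Suc n)"
        using t tr[OF s] by (auto simp: stabilizer_def)
    qed simp
  qed
qed

text \<open>Induction on the degree. As \<open>h\<close> is a right inverse of the boundary on
  reduced cycles, \<open>s - h (\<partial> s)\<close> is a cycle; filling it equivariantly gives the
  next \<open>h\<close>, with \<open>\<partial> h = id - h \<partial>\<close>. That
  \<open>h s\<close> lives on the fixed points of the stabiliser belongs to the induction, because
  the next cycle must lie in the subcomplex where it is to be filled.\<close>

lemma equivariant_contraction:
  fixes R :: "'r::comm_ring_1 set"
  assumes R: "coefficient_ring R"
    and ac: "\<And>Q. subgroup Q G \<Longrightarrow> acyclic_over R (fixed_points Y \<phi> Q)"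
  shows "\<exists>h.
    (\<forall>s\<in>simplices Y n. h s \<in> chains R (fixed_points Y \<phi> (stabilizer G (\<phi> n) s)) (Suc n)) \<and>
    (\<forall>g\<in>carrier G. \<forall>s\<in>simplices Y n. h (\<phi> n g s) = push (\<phi> (Suc n) g) (h s)) \<and>
    (\<forall>c\<in>reduced_cycles R Y n. boundary Y (Suc n) (linear_extension h c) = c)"
proof (induction n)
  case 0
  interpret coefficient_ring R by (rule R)
  \<comment> \<open>The fixed points of the whole group contain a vertex; collapsing onto it is
    equivariant.\<close>
  obtain x where x: "x \<in> simplices Y 0" "\<And>g. g \<in> carrier G \<Longrightarrow> \<phi> 0 g x = x"
    using ac[OF subgroup_self] by (auto simp: acyclic_over_def)
  obtain h where h:
    "\<And>s. s \<in> simplices Y 0 \<Longrightarrow> h s \<in> chains R (fixed_points Y \<phi> (stabilizer G (\<phi> 0) s)) (Suc 0)"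
    "\<And>g s. g \<in> carrier G \<Longrightarrow> s \<in> simplices Y 0 \<Longrightarrow> h (\<phi> 0 g s) = push (\<phi> (Suc 0) g) (h s)"
    "\<And>s. s \<in> simplices Y 0 \<Longrightarrow> boundary Y (Suc 0) (h s) =
      Poly_Mapping.single s 1 - Poly_Mapping.single x 1"
    by (rule equivariant_filling[OF R ac, of 0 "\<lambda>s. Poly_Mapping.single x 1"])
      (auto simp: reduced_cycles_def linear_extension_diff x stabilizer_def
        intro!: diff_chains single_chains)
  have "boundary Y (Suc 0) (linear_extension h c) = c" if "c \<in> reduced_cycles R Y 0" for c
  proof -
    have "boundary Y (Suc 0) (linear_extension h c) =
        linear_extension (\<lambda>s. Poly_Mapping.single s 1 - Poly_Mapping.single x 1) c"
      using h(3) that unfolding boundary_eq linear_extension_linear_extension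
      by (intro linear_extension_cong) (auto simp: reduced_cycles_def chains_def)
    also have "\<dots> = c - push (\<lambda>u. x) (augmentation c)"
      by (simp add: linear_extension_fun_diff linear_extension_linear_extension)
    finally show ?thesis using that by (simp add: reduced_cycles_def)
  qed
  then show ?case using h by blast
next
  case (Suc n)
  interpret coefficient_ring R by (rule R)
  obtain h where h:
    "\<And>s. s \<in> simplices Y n \<Longrightarrow> h s \<in> chains R (fixed_points Y \<phi> (stabilizer G (\<phi> n) s)) (Suc n)"
    "\<And>g s. g \<in> carrier G \<Longrightarrow> s \<in> simplices Y n \<Longrightarrow> h (\<phi> n g s) = push (\<phi> (Suc n) g) (h s)"
    "\<And>c. c \<in> reduced_cycles R Y n \<Longrightarrow> boundary Y (Suc n) (linear_extension h c) = c"
    using Suc by blast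
  define k where "k s = linear_extension h (simplex_boundary Y (Suc n) s)" for s
  have sb: "simplex_boundary Y (Suc n) s \<in> chains R Y n" if "s \<in> simplices Y (Suc n)" for s
    by (rule simplex_boundary_chains[OF simplicial that])
  have "Poly_Mapping.single s 1 - k s \<in>
      reduced_cycles R (fixed_points Y \<phi> (stabilizer G (\<phi> (Suc n)) s)) (Suc n)"
    if s: "s \<in> simplices Y (Suc n)" for s
  proof -
    let ?F = "fixed_points Y \<phi> (stabilizer G (\<phi> (Suc n)) s)"
    have F: "simplicial_set ?F" "s \<in> simplices ?F (Suc n)"
      using s by (auto intro!: simplicial_fixed_points simp: stabilizer_def)
    have "k s \<in> chains R ?F (Suc n)"
      unfolding k_def
    proof (rule linear_extension_chains)
      show "simplex_boundary Y (Suc n) s \<in> chains R ?F n"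
        using simplex_boundary_chains[OF F] by simp
      fix t assume t: "t \<in> simplices ?F n"
      \<comment> \<open>A simplex \<open>t\<close> fixed by the stabiliser of \<open>s\<close> has a
        stabiliser at least as large, and a larger group has fewer fixed simplices.\<close>
      then have "stabilizer G (\<phi> (Suc n)) s \<subseteq> stabilizer G (\<phi> n) t"
        by (auto simp: stabilizer_def)
      then have "chains R (fixed_points Y \<phi> (stabilizer G (\<phi> n) t)) (Suc n) \<subseteq> chains R ?F (Suc n)"
        by (intro chains_mono) auto
      then show "h t \<in> chains R ?F (Suc n)" using h(1) t by auto
    qed
    \<comment> \<open>The boundary of \<open>s\<close> is a reduced cycle, so \<open>h\<close>
      followed by the boundary returns it.\<close>
    moreover have "boundary Y (Suc n) (k s) = simplex_boundary Y (Suc n) s"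
      unfolding k_def
      using boundary_reduced_cycles[OF simplicial single_chains[OF s one_mem]]
      by (intro h(3)) (simp add: boundary_eq)
    ultimately show ?thesis
      using F by (auto simp: reduced_cycles_def boundary_eq linear_extension_diff
          intro!: diff_chains single_chains)
  qed
  moreover have "k (\<phi> (Suc n) g s) = push (\<phi> (Suc n) g) (k s)"
    if "g \<in> carrier G" "s \<in> simplices Y (Suc n)" for g s
  proof -
    have "k (\<phi> (Suc n) g s) =
        linear_extension (\<lambda>t. h (\<phi> n g t)) (simplex_boundary Y (Suc n) s)"
      using that by (simp add: k_def simplex_boundary_act linear_extension_linear_extension)
    also have "\<dots> = linear_extension (\<lambda>t. push (\<phi> (Suc n) g) (h t)) (simplex_boundary Y (Suc n) s)"
      using that sb[of s] by (intro linear_extension_cong h(2)) (auto simp: chains_def)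
    also have "\<dots> = push (\<phi> (Suc n) g) (k s)"
      by (simp add: k_def linear_extension_linear_extension)
    finally show ?thesis .
  qed
  ultimately obtain h' where h':
    "\<And>s. s \<in> simplices Y (Suc n) \<Longrightarrow>
      h' s \<in> chains R (fixed_points Y \<phi> (stabilizer G (\<phi> (Suc n)) s)) (Suc (Suc n))"
    "\<And>g s. g \<in> carrier G \<Longrightarrow> s \<in> simplices Y (Suc n) \<Longrightarrow>
      h' (\<phi> (Suc n) g s) = push (\<phi> (Suc (Suc n)) g) (h' s)"
    "\<And>s. s \<in> simplices Y (Suc n) \<Longrightarrow> boundary Y (Suc (Suc n)) (h' s) = Poly_Mapping.single s 1 - k s"
    using equivariant_filling[OF R ac, of "Suc n" k] by blast
  have "boundary Y (Suc (Suc n)) (linear_extension h' c) = c"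
    if "c \<in> reduced_cycles R Y (Suc n)" for c
  proof -
    have "boundary Y (Suc (Suc n)) (linear_extension h' c) =
        linear_extension (\<lambda>s. Poly_Mapping.single s 1 - k s) c"
      using h'(3) that unfolding boundary_eq linear_extension_linear_extension
      by (intro linear_extension_cong) (auto simp: reduced_cycles_def chains_def)
    also have "\<dots> = c - linear_extension h (boundary Y (Suc n) c)"
      by (simp add: linear_extension_fun_diff linear_extension_linear_extension k_def boundary_eq)
    finally show ?thesis using that by (simp add: reduced_cycles_def)
  qed
  then show ?case using h' by blast
qed

lemma simplicial_action_subgroup:
  assumes "subgroup S G"
  shows "simplicial_action (G\<lparr>carrier := S\<rparr>) Y \<phi>"
proof -
  interpret S: group "G\<lparr>carrier := S\<rparr>" by (rule subgroup_imp_group[OF assms])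
  show ?thesis
    using subgroup.mem_carrier[OF assms] simplicial act_mult act_smap
    by unfold_locales auto
qed

text \<open>
  With \<open>N\<close> the sum over the translates of a representative of an orbit and \<open>h\<close> an
  \<open>S\<close>-equivariant contraction of \<open>Y\<close>, a cycle \<open>z\<close> of the orbit space satisfies
  \<open>|G| z = \<partial> (\<pi> (h (N z)))\<close>. The chain on the right is divisible by \<open>|S|\<close>, because \<open>\<pi> \<circ> h\<close> is
  constant along \<open>S\<close>-orbits, so only the index of \<open>S\<close> has to be inverted.
\<close>

theorem acyclic_over_orbit_space:
  fixes R :: "'r::field_char_0 set"
  assumes R: "coefficient_ring R" and fin: "finite (carrier G)" and S: "subgroup S G"
    and idx: "inverse (of_nat (card (rcosets S))) \<in> R"
    and ac: "\<And>Q. subgroup Q G \<Longrightarrow> Q \<subseteq> S \<Longrightarrow> acyclic_over R (fixed_points Y \<phi> Q)"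
  shows "acyclic_over R (orbit_space G (carrier G) \<phi> Y)"
proof -
  interpret coefficient_ring R by (rule R)
  interpret S: simplicial_action "G\<lparr>carrier := S\<rparr>" Y \<phi>
    by (rule simplicial_action_subgroup[OF S])
  have Sc: "s \<in> carrier G" if "s \<in> S" for s
    using S that by (rule subgroup.mem_carrier)
  define Z where "Z = orbit_space G (carrier G) \<phi> Y"
  define \<pi> where "\<pi> n s = orbit G (\<phi> n) s" for n s
  define r where "r n A = (SOME s. s \<in> simplices Y n \<and> \<pi> n s = A)" for n A
  \<comment> \<open>The sum runs over group elements, not over the distinct simplices of the orbit.
    Stabilisers can grow on passing to a face, and only the count with multiplicity commutes with
    the boundary.\<close>
  define N where "N n A = (\<Sum>g\<in>carrier G. Poly_Mapping.single (\<phi> n g (r n A)) (1::'r))" for n A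
  have Z: "simplices Z n = \<pi> n ` simplices Y n" for n
    by (auto simp: Z_def \<pi>_def orbit_space_def orbits_def)
  have r: "r n A \<in> simplices Y n" "\<pi> n (r n A) = A" if "A \<in> simplices Z n" for n A
    using someI_ex[of "\<lambda>s. s \<in> simplices Y n \<and> \<pi> n s = A"] that by (auto simp: Z r_def)
  have \<pi>_act: "\<pi> n (\<phi> n g s) = \<pi> n s" if "g \<in> carrier G" "s \<in> simplices Y n" for n g s
    using orbit_act[OF that] by (simp add: \<pi>_def)
  have face_Z: "face Z (Suc n) i (\<pi> (Suc n) s) = \<pi> n (face Y (Suc n) i s)"
    if s: "s \<in> simplices Y (Suc n)" and i: "i \<le> Suc n" for n i s
  proof -
    have "\<pi> m t = (\<lambda>g. \<phi> m g t) ` carrier G" for m t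
      by (auto simp: \<pi>_def orbit_def)
    moreover have "face Z (Suc n) i A = face Y (Suc n) i ` A" for A
      by (simp add: face_def Z_def orbit_space_def)
    ultimately show ?thesis
      using face_act[OF _ s i] by (simp add: image_image)
  qed
  have N: "N n (\<pi> n s) = (\<Sum>g\<in>carrier G. Poly_Mapping.single (\<phi> n g s) 1)"
    if s: "s \<in> simplices Y n" for n s
  proof -
    have "\<pi> n s \<in> simplices Z n" using s by (simp add: Z)
    then have "s \<in> \<pi> n (r n (\<pi> n s))" "r n (\<pi> n s) \<in> simplices Y n"
      using r s act_one[OF s] by (force simp: \<pi>_def orbit_def)+
    then obtain h where h: "h \<in> carrier G" "s = \<phi> n h (r n (\<pi> n s))"
      by (auto simp: \<pi>_def orbit_def)
    \<comment> \<open>Right translation by \<open>h\<close> absorbs the change of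
      representative.\<close>
    have bij: "bij_betw (\<lambda>g. g \<otimes> h) (carrier G) (carrier G)"
      using h by (intro bij_betw_byWitness[where f' = "\<lambda>g. g \<otimes> inv h"]) (auto simp: m_assoc)
    have "(\<Sum>g\<in>carrier G. Poly_Mapping.single (\<phi> n g s) (1::'r)) =
        (\<Sum>g\<in>carrier G. Poly_Mapping.single (\<phi> n (g \<otimes> h) (r n (\<pi> n s))) 1)"
      using h \<open>r n (\<pi> n s) \<in> simplices Y n\<close> by (intro sum.cong) (auto simp: act_mult)
    also have "\<dots> = N n (\<pi> n s)"
      unfolding N_def by (rule sum.reindex_bij_betw[OF bij])
    finally show ?thesis by simp
  qed
  have N_chains: "N n A \<in> chains R Y n" if "A \<in> simplices Z n" for n A
    using r[OF that] by (auto simp: N_def intro!: sum_chains single_chains)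
  have boundary_N: "boundary Y (Suc n) (linear_extension (N (Suc n)) z) =
      linear_extension (N n) (boundary Z (Suc n) z)" if z: "z \<in> chains R Z (Suc n)" for n z
    unfolding boundary_eq linear_extension_linear_extension
  proof (rule linear_extension_cong)
    fix A assume "A \<in> Poly_Mapping.keys z"
    then obtain s where s: "s \<in> simplices Y (Suc n)" "A = \<pi> (Suc n) s"
      using z by (auto simp: chains_def Z)
    have "linear_extension (simplex_boundary Y (Suc n)) (N (Suc n) A) =
        (\<Sum>g\<in>carrier G. \<Sum>i\<le>Suc n. Poly_Mapping.single (\<phi> n g (face Y (Suc n) i s)) ((-1) ^ i))"
      using s by (simp add: N linear_extension_sum simplex_boundary_def face_act del: sum.atMost_Suc)
    also have "\<dots> =
        (\<Sum>i\<le>Suc n. \<Sum>g\<in>carrier G. Poly_Mapping.single (\<phi> n g (face Y (Suc n) i s)) ((-1) ^ i))"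
      by (rule sum.swap)
    also have "\<dots> = linear_extension (N n) (simplex_boundary Z (Suc n) A)"
      using s by (simp add: simplex_boundary_def face_Z linear_extension_sum scale_sum
          N face_simplices[OF simplicial] del: sum.atMost_Suc)
    finally show "linear_extension (simplex_boundary Y (Suc n)) (N (Suc n) A) =
      linear_extension (N n) (simplex_boundary Z (Suc n) A)" .
  qed
  have augmentation_N: "augmentation (linear_extension (N n) z) =
      scale (of_nat (card (carrier G))) (augmentation z)" for n z
    unfolding linear_extension_linear_extension
    by (simp add: N_def linear_extension_sum sum_const_scale linear_extension_fun_scale[symmetric])
  have push_N: "push (\<pi> n) (linear_extension (N n) z) = scale (of_nat (card (carrier G))) z"
    if z: "z \<in> chains R Z n" for n z
  proof -
    have "push (\<pi> n) (linear_extension (N n) z) =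
        linear_extension (\<lambda>A. scale (of_nat (card (carrier G))) (Poly_Mapping.single A 1)) z"
      unfolding linear_extension_linear_extension
    proof (rule linear_extension_cong)
      fix A assume "A \<in> Poly_Mapping.keys z"
      then have "A \<in> simplices Z n" using z by (auto simp: chains_def)
      then show "push (\<pi> n) (N n A) = scale (of_nat (card (carrier G))) (Poly_Mapping.single A 1)"
        using r[of A n] \<pi>_act by (simp add: N_def linear_extension_sum sum_const_scale)
    qed
    then show ?thesis by (simp only: linear_extension_fun_scale linear_extension_basis)
  qed
  have fill: "reduced_cycles R Z n \<subseteq> boundary Z (Suc n) ` chains R Z (Suc n)" for n
  proof
    fix z assume z: "z \<in> reduced_cycles R Z n"
    then have zc: "z \<in> chains R Z n" by (simp add: reduced_cycles_def)
    \<comment> \<open>For the action of \<open>S\<close> the relevant subgroups lie in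
      \<open>S\<close>, where \<open>ac\<close> applies.\<close>
    have "\<exists>h. (\<forall>s\<in>simplices Y n.
          h s \<in> chains R (fixed_points Y \<phi> (stabilizer (G\<lparr>carrier := S\<rparr>) (\<phi> n) s)) (Suc n)) \<and>
        (\<forall>g\<in>carrier (G\<lparr>carrier := S\<rparr>). \<forall>s\<in>simplices Y n. h (\<phi> n g s) = push (\<phi> (Suc n) g) (h s)) \<and>
        (\<forall>c\<in>reduced_cycles R Y n. boundary Y (Suc n) (linear_extension h c) = c)"
    proof (rule S.equivariant_contraction[OF R])
      fix Q assume "subgroup Q (G\<lparr>carrier := S\<rparr>)"
      then show "acyclic_over R (fixed_points Y \<phi> Q)"
        using incl_subgroup[OF S] subgroup.subset by (intro ac) fastforce+
    qed
    then obtain h where h0: "\<And>s. s \<in> simplices Y n \<Longrightarrow>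
          h s \<in> chains R (fixed_points Y \<phi> (stabilizer (G\<lparr>carrier := S\<rparr>) (\<phi> n) s)) (Suc n)"
      and h_act: "\<And>g s. g \<in> S \<Longrightarrow> s \<in> simplices Y n \<Longrightarrow> h (\<phi> n g s) = push (\<phi> (Suc n) g) (h s)"
      and h_boundary: "\<And>c. c \<in> reduced_cycles R Y n \<Longrightarrow>
        boundary Y (Suc n) (linear_extension h c) = c"
      by simp blast
    have h: "h s \<in> chains R Y (Suc n)" if "s \<in> simplices Y n" for s
      using h0[OF that] by (auto simp: chains_def)
    let ?Nz = "linear_extension (N n) z"
    have Nz: "?Nz \<in> chains R Y n"
      using zc N_chains by (rule linear_extension_chains)
    have hNz: "linear_extension h ?Nz \<in> chains R Y (Suc n)"
      using Nz h by (rule linear_extension_chains)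
    have "?Nz \<in> reduced_cycles R Y n"
    proof (cases n)
      case 0
      then show ?thesis using z Nz by (simp add: reduced_cycles_def augmentation_N)
    next
      case (Suc m)
      then show ?thesis using z Nz boundary_N[of z m] by (simp add: reduced_cycles_def)
    qed
    then have "push (\<pi> n) (boundary Y (Suc n) (linear_extension h ?Nz)) =
        scale (of_nat (card (carrier G))) z"
      by (simp add: h_boundary push_N[OF zc])
    moreover have "boundary Z (Suc n) (push (\<pi> (Suc n)) (linear_extension h ?Nz)) =
        push (\<pi> n) (boundary Y (Suc n) (linear_extension h ?Nz))"
      using hNz by (intro boundary_push face_Z) (auto simp: chains_def)
    ultimately have 1: "boundary Z (Suc n) (push (\<pi> (Suc n)) (linear_extension h ?Nz)) =
        scale (of_nat (card (carrier G))) z"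
      by simp
    have \<pi>h: "push (\<pi> (Suc n)) (h s) \<in> chains R Z (Suc n)" if "s \<in> simplices Y n" for s
      using h[OF that] by (rule linear_extension_chains) (auto simp: Z intro: single_chains)
    \<comment> \<open>The factor \<open>card S\<close> is extracted on each generator
      \<open>A\<close>, with a quotient that has coefficients in \<open>R\<close> by construction;
      division in the field would not show this.\<close>
    have "\<exists>w\<in>chains R Z (Suc n). push (\<pi> (Suc n)) (linear_extension h (N n A)) =
        scale (of_nat (card S)) w" if A: "A \<in> simplices Z n" for A
    proof -
      define f where "f g = push (\<pi> (Suc n)) (h (\<phi> n g (r n A)))" for g
      have inv: "f (s \<otimes> g) = f g" if s: "s \<in> S" and g: "g \<in> carrier G" for s g
      proof -
        have y: "\<phi> n g (r n A) \<in> simplices Y n" using g r[OF A] by simp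
        \<comment> \<open>Equivariance of \<open>h\<close> brings \<open>s\<close> to the outside,
          where the projection to orbits forgets it.\<close>
        have "f (s \<otimes> g) = push (\<pi> (Suc n)) (push (\<phi> (Suc n) s) (h (\<phi> n g (r n A))))"
          using s g r[OF A] Sc y by (simp add: f_def act_mult h_act)
        also have "\<dots> = f g"
          unfolding f_def linear_extension_linear_extension
          using h[OF y] Sc[OF s] by (intro linear_extension_cong) (auto simp: chains_def \<pi>_act subset_iff)
        finally show ?thesis .
      qed
      have "push (\<pi> (Suc n)) (linear_extension h (N n A)) = (\<Sum>g\<in>carrier G. f g)"
        by (simp add: N_def f_def linear_extension_sum)
      also have "\<dots> = (\<Sum>C\<in>rcosets S. \<Sum>s\<in>S. f (SOME g. g \<in> C))"
        by (rule sum_rcosets[OF fin S inv])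
      also have "\<dots> = scale (of_nat (card S)) (\<Sum>C\<in>rcosets S. f (SOME g. g \<in> C))"
        by (simp add: sum_const_scale scale_sum)
      finally have "push (\<pi> (Suc n)) (linear_extension h (N n A)) =
        scale (of_nat (card S)) (\<Sum>C\<in>rcosets S. f (SOME g. g \<in> C))" .
      moreover have "(\<Sum>C\<in>rcosets S. f (SOME g. g \<in> C)) \<in> chains R Z (Suc n)"
      proof (rule sum_chains)
        fix C assume C: "C \<in> rcosets S"
        then obtain a where "a \<in> carrier G" "C = S #> a" by (auto simp: RCOSETS_def)
        then have "a \<in> C" using rcos_self S by simp
        then have "(SOME g. g \<in> C) \<in> C" by (rule someI)
        then have "(SOME g. g \<in> C) \<in> carrier G"
          using C rcosets_part_G[OF S] by blast
        then show "f (SOME g. g \<in> C) \<in> chains R Z (Suc n)"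
          using r[OF A] by (simp add: f_def \<pi>h)
      qed
      ultimately show ?thesis by blast
    qed
    then obtain w where w: "\<And>A. A \<in> simplices Z n \<Longrightarrow> w A \<in> chains R Z (Suc n)"
      "\<And>A. A \<in> simplices Z n \<Longrightarrow> push (\<pi> (Suc n)) (linear_extension h (N n A)) =
        scale (of_nat (card S)) (w A)"
      by metis
    have wz: "linear_extension w z \<in> chains R Z (Suc n)"
      using zc w(1) by (rule linear_extension_chains)
    have "push (\<pi> (Suc n)) (linear_extension h ?Nz) =
        linear_extension (\<lambda>A. scale (of_nat (card S)) (w A)) z"
      unfolding linear_extension_linear_extension
      using zc w(2) by (intro linear_extension_cong)
        (auto simp: chains_def linear_extension_linear_extension)
    then have "scale (of_nat (card S)) (boundary Z (Suc n) (linear_extension w z)) =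
        scale (of_nat (card (carrier G))) z"
      using 1 by (simp add: linear_extension_fun_scale boundary_eq linear_extension_scale)
    \<comment> \<open>\<open>card S\<close> need not be a unit of \<open>R\<close>; it is cancelled
      in the ambient field, between chains already known to be over \<open>R\<close>.\<close>
    then have "scale (inverse (of_nat (card S)))
          (scale (of_nat (card S)) (boundary Z (Suc n) (linear_extension w z))) =
        scale (inverse (of_nat (card S))) (scale (of_nat (card (carrier G))) z)"
      by simp
    moreover have card: "card (carrier G) = card (rcosets S) * card S"
      using lagrange[OF S] by (simp add: order_def)
    moreover have "card S \<noteq> 0" "card (rcosets S) \<noteq> 0"
      using card fin by (metis card_eq_0_iff mult_is_0 one_closed empty_iff)+
    ultimately have "boundary Z (Suc n) (linear_extension w z) =
        scale (of_nat (card (rcosets S))) z"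
      by (simp add: field_simps)
    then have "boundary Z (Suc n) (scale (inverse (of_nat (card (rcosets S)))) (linear_extension w z)) = z"
      using \<open>card (rcosets S) \<noteq> 0\<close> by (simp add: boundary_eq linear_extension_scale)
    then show "z \<in> boundary Z (Suc n) ` chains R Z (Suc n)"
      using scale_chains[OF idx wz] by (metis imageI)
  qed
  have "simplices Y 0 \<noteq> {}"
    using ac[OF triv_subgroup] subgroup.one_closed[OF S] by (auto simp: acyclic_over_def)
  then show ?thesis
    using fill Z unfolding acyclic_over_def Z_def by auto
qed

end

text \<open>If \<open>x\<close> fixes \<open>s\<close> and commutes with \<open>k\<close>, then
  \<open>x\<close> fixes the translate of \<open>s\<close> by \<open>k\<close>.\<close>

lemma (in simplicial_action) simplicial_action_fixed_points:
  assumes K: "subgroup K G" and P: "P \<subseteq> carrier G"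
    and comm: "\<And>k x. k \<in> K \<Longrightarrow> x \<in> P \<Longrightarrow> k \<otimes> x = x \<otimes> k"
  shows "simplicial_action (G\<lparr>carrier := K\<rparr>) (fixed_points Y \<phi> P) \<phi>"
proof -
  interpret K: simplicial_action "G\<lparr>carrier := K\<rparr>" Y \<phi>
    by (rule simplicial_action_subgroup[OF K])
  have KG: "k \<in> carrier G" if "k \<in> K" for k
    using K that by (rule subgroup.mem_carrier)
  have "\<phi> n x (\<phi> n k s) = \<phi> n k s" if "k \<in> K" "x \<in> P" "s \<in> simplices (fixed_points Y \<phi> P) n" for k x n s
  proof -
    have "\<phi> n x (\<phi> n k s) = \<phi> n (x \<otimes> k) s" using that KG P by (auto simp: act_mult)
    also have "\<dots> = \<phi> n k (\<phi> n x s)" using that KG P by (auto simp: act_mult simp flip: comm)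
    finally show ?thesis using that by simp
  qed
  then show ?thesis
    using simplicial_fixed_points[OF P] KG act_mult act_smap
    by unfold_locales (auto simp: fixed_points_def)
qed

text \<open>Replaces iterated fixed points by those of a single set, which can then be recognised as
  a member of the collection.\<close>

lemma (in simplicial_action) fixed_points_fixed_points:
  assumes P: "subgroup P G" and Q: "subgroup Q G"
  shows "fixed_points (fixed_points Y \<phi> P) \<phi> Q = fixed_points Y \<phi> (P <#> Q)"
proof -
  have PQ: "x \<in> carrier G" if "x \<in> P \<or> x \<in> Q" for x
    using P Q that by (auto dest: subgroup.mem_carrier)
  have "(\<forall>g\<in>P. \<phi> n g s = s) \<and> (\<forall>g\<in>Q. \<phi> n g s = s) \<longleftrightarrow> (\<forall>g\<in>P <#> Q. \<phi> n g s = s)"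
    if s: "s \<in> simplices Y n" for n s
  proof
    assume h: "\<forall>g\<in>P <#> Q. \<phi> n g s = s"
    have "x \<in> P <#> Q" if "x \<in> P" for x
    proof -
      have "x = x \<otimes> \<one>" using that PQ by simp
      then show ?thesis
        using that subgroup.one_closed[OF Q] unfolding set_mult_def by blast
    qed
    moreover have "x \<in> P <#> Q" if "x \<in> Q" for x
    proof -
      have "x = \<one> \<otimes> x" using that PQ by simp
      then show ?thesis
        using that subgroup.one_closed[OF P] unfolding set_mult_def by blast
    qed
    ultimately show "(\<forall>g\<in>P. \<phi> n g s = s) \<and> (\<forall>g\<in>Q. \<phi> n g s = s)" using h by blast
  qed (use s PQ in \<open>auto simp: set_mult_def act_mult\<close>)
  then have "{s \<in> simplices (fixed_points Y \<phi> P) n. \<forall>g\<in>Q. \<phi> n g s = s} =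
      simplices (fixed_points Y \<phi> (P <#> Q)) n" for n
    unfolding simplices_fixed_points by blast
  then show ?thesis by (simp add: fixed_points_def)
qed

section \<open>The space \<open>E\<^sub>C G\<close>\<close>

context group
begin

lemma mem_simplices_E_space:
  "(ob, mor) \<in> simplices (E_space G \<C>) n \<longleftrightarrow>
     ob \<in> {..n} \<rightarrow>\<^sub>E {(H, A). H \<in> \<C> \<and> A \<in> lcosets H} \<and>
     (\<forall>i j. i \<le> j \<and> j \<le> n \<longrightarrow>
        mor i j \<in> G_maps G (fst (ob i)) (fst (ob j)) \<and> mor i j (snd (ob i)) = snd (ob j)) \<and>
     (\<forall>i j. \<not> (i \<le> j \<and> j \<le> n) \<longrightarrow> mor i j = undefined) \<and>
     (\<forall>i\<le>n. mor i i = (\<lambda>B\<in>lcosets (fst (ob i)). B)) \<and>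
     (\<forall>i j k. i \<le> j \<and> j \<le> k \<and> k \<le> n \<longrightarrow>
        mor i k = compose (lcosets (fst (ob i))) (mor j k) (mor i j))"
  by (simp add: E_space_def nerve_def pointed_orbit_category_def case_prod_beta)

lemma l_coset_lcosets:
  assumes "subgroup H G" "g \<in> carrier G" "A \<in> lcosets H"
  shows "g <# A \<in> lcosets H"
  using assms by (auto simp: LCOSETS_def lcos_m_assoc subgroup.subset)

lemma simplicial_action_E_space:
  assumes sub: "\<And>H. H \<in> \<C> \<Longrightarrow> subgroup H G"
  shows "simplicial_action G (E_space G \<C>) (E_action G)"
proof -
  have carr: "A \<subseteq> carrier G" if "H \<in> \<C>" "A \<in> lcosets H" for H A
    using subgroup.lcosets_carrier[OF sub is_group] that by auto
  have obD: "fst (ob i) \<in> \<C>" "snd (ob i) \<in> lcosets (fst (ob i))"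
    if "(ob, mor) \<in> simplices (E_space G \<C>) n" "i \<le> n" for ob n i
      and mor :: "nat \<Rightarrow> nat \<Rightarrow> 'a set \<Rightarrow> 'a set"
    using that by (fastforce simp: mem_simplices_E_space PiE_def Pi_def)+
  have ext: "ob i = undefined" if "(ob, mor) \<in> simplices (E_space G \<C>) n" "\<not> i \<le> n" for ob n i
      and mor :: "nat \<Rightarrow> nat \<Rightarrow> 'a set \<Rightarrow> 'a set"
    using that by (auto simp: mem_simplices_E_space PiE_def extensional_def)
  show ?thesis
  proof unfold_locales
    show "simplicial_set (E_space G \<C>)"
      unfolding E_space_def by (rule simplicial_set_nerve)
  next
    fix n g s assume g: "g \<in> carrier G" and s: "s \<in> simplices (E_space G \<C>) n"
    obtain ob mor where obm: "s = (ob, mor)" by (cases s)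
    have E: "E_action G n g s = (\<lambda>i\<in>{..n}. (fst (ob i), g <# snd (ob i)), mor)"
      by (simp add: E_action_def obm case_prod_beta)
    have 1: "fst (ob i) \<in> \<C>" "snd (ob i) \<in> lcosets (fst (ob i))" if "i \<le> n" for i
      using obD[of ob mor n i] s that obm by auto
    have 2: "mor i j \<in> G_maps G (fst (ob i)) (fst (ob j))" "mor i j (snd (ob i)) = snd (ob j)"
      if "i \<le> j" "j \<le> n" for i j
      using s that unfolding obm mem_simplices_E_space by blast+
    have 3: "mor i j = undefined" if "\<not> (i \<le> j \<and> j \<le> n)" for i j
      using s that unfolding obm mem_simplices_E_space by blast
    have 4: "mor i i = (\<lambda>B\<in>lcosets (fst (ob i)). B)" if "i \<le> n" for i
      using s that unfolding obm mem_simplices_E_space by blast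
    have 5: "mor i k = compose (lcosets (fst (ob i))) (mor j k) (mor i j)"
      if "i \<le> j" "j \<le> k" "k \<le> n" for i j k
      using s that unfolding obm mem_simplices_E_space by blast
    have 6: "g <# snd (ob i) \<in> lcosets (fst (ob i))" if "i \<le> n" for i
      using 1[OF that] g by (intro l_coset_lcosets sub)
    \<comment> \<open>Equivariance of a \<open>G\<close>-map lets the same map serve between the
      translated objects.\<close>
    have 7: "mor i j (g <# snd (ob i)) = g <# snd (ob j)" if "i \<le> j" "j \<le> n" for i j
      using 1[of i] 2[OF that] that g by (simp add: G_maps_def)
    show "E_action G n g s \<in> simplices (E_space G \<C>) n"
      unfolding E mem_simplices_E_space
    proof (intro conjI allI impI)
      fix i k :: nat and j assume "i \<le> j \<and> j \<le> k \<and> k \<le> n"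
      then show "mor i k = compose (lcosets (fst ((\<lambda>i\<in>{..n}. (fst (ob i), g <# snd (ob i))) i)))
          (mor j k) (mor i j)"
        using 5[of i j k] by simp
    qed (simp_all add: 1 2 3 4 6 7)
  next
    fix n s assume s: "s \<in> simplices (E_space G \<C>) n"
    obtain ob mor where obm: "s = (ob, mor)" by (cases s)
    have "\<one> <# snd (ob i) = snd (ob i)" if "i \<le> n" for i
      using obD[of ob mor n i] s that obm carr by (intro lcos_mult_one) auto
    then show "E_action G n \<one> s = s"
      using ext[of ob mor n] s obm by (auto simp: E_action_def fun_eq_iff case_prod_beta)
  next
    fix g h n s assume gh: "g \<in> carrier G" "h \<in> carrier G" and s: "s \<in> simplices (E_space G \<C>) n"
    obtain ob mor where obm: "s = (ob, mor)" by (cases s)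
    have "(g \<otimes> h) <# snd (ob i) = g <# (h <# snd (ob i))" if "i \<le> n" for i
      using obD[of ob mor n i] s that obm carr gh by (intro lcos_m_assoc[symmetric]) auto
    then show "E_action G n (g \<otimes> h) s = E_action G n g (E_action G n h s)"
      using obm by (auto simp: E_action_def fun_eq_iff case_prod_beta)
  qed (simp add: E_action_smap)
qed

text \<open>If \<open>QA = A\<close>, then \<open>(gQ)A = gA\<close>, so the product of subsets
  gives the map without a choice of coset representatives.\<close>

definition initial_map :: "'a set \<Rightarrow> 'a set \<Rightarrow> 'a set \<Rightarrow> 'a set" where
  "initial_map Q A = (\<lambda>B\<in>lcosets Q. B <#> A)"

text \<open>The object \<open>(Q, Q)\<close> is put in front of the chain. In the second branch
  \<open>i\<close> was positive and at most \<open>j\<close>, so \<open>j - 1\<close> is a true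
  predecessor.\<close>

definition cone :: "'a set \<Rightarrow> nat \<Rightarrow> ('a set \<times> 'a set, 'a set \<Rightarrow> 'a set) nerve_simplex \<Rightarrow>
    ('a set \<times> 'a set, 'a set \<Rightarrow> 'a set) nerve_simplex" where
  "cone Q n = (\<lambda>(ob, mor). let ob' = case_nat (Q, Q) ob in
     (\<lambda>i\<in>{..Suc n}. ob' i,
      \<lambda>i j. if i \<le> j \<and> j \<le> Suc n
        then (case i of 0 \<Rightarrow> initial_map Q (snd (ob' j)) | Suc i \<Rightarrow> mor i (j - 1))
        else undefined))"

text \<open>\<open>initial_map Q Q\<close> is the identity in disguise; this form matches the last
  face of a cone on a vertex.\<close>

definition apex :: "'a set \<Rightarrow> ('a set \<times> 'a set, 'a set \<Rightarrow> 'a set) nerve_simplex" where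
  "apex Q = (\<lambda>i\<in>{..0}. (Q, Q), \<lambda>i j. if i \<le> j \<and> j \<le> 0 then initial_map Q Q else undefined)"

text \<open>
  For \<open>Q \<in> \<C>\<close>, an object \<open>(H, A)\<close> is fixed by \<open>Q\<close> iff there is a (necessarily unique) morphism to
  it from \<open>(Q, Q)\<close>, namely \<open>gQ \<mapsto> gA\<close>.
\<close>

lemma extra_degeneracy_fixed_points_E_space:
  assumes sub: "\<And>H. H \<in> \<C> \<Longrightarrow> subgroup H G" and Q: "Q \<in> \<C>"
  shows "extra_degeneracy (fixed_points (E_space G \<C>) (E_action G) Q) (apex Q) (cone Q)"
proof -
  let ?F = "fixed_points (E_space G \<C>) (E_action G) Q"
  have subQ: "subgroup Q G" by (rule sub[OF Q])
  have Qc: "Q \<subseteq> carrier G" by (rule subgroup.subset[OF subQ])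
  have QQ: "Q \<in> lcosets Q"
    using lcos_mult_one[OF Qc] by (force simp: LCOSETS_def)
  have fixQ: "g <# Q = Q" if "g \<in> Q" for g
    using l_repr_independence[of g \<one> Q] lcos_mult_one[OF Qc] that subQ by simp
  have init: "initial_map Q A (g <# Q) = g <# A" "initial_map Q A \<in> G_maps G Q H"
      "initial_map Q A Q = A"
    if H: "H \<in> \<C>" and A: "A \<in> lcosets H" and fx: "\<And>q. q \<in> Q \<Longrightarrow> q <# A = A" and g: "g \<in> carrier G"
    for A H g
  proof -
    have Ac: "A \<subseteq> carrier G" using subgroup.lcosets_carrier[OF sub is_group] that by auto
    have QA: "Q <#> A = A"
    proof -
      have "Q <#> A = (\<Union>q\<in>Q. q <# A)" by (auto simp: set_mult_def l_coset_def)
      then show ?thesis using fx subgroup.one_closed[OF subQ] by auto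
    qed
    have co: "initial_map Q A (g <# Q) = g <# A" if "g \<in> carrier G" for g
      using that setmult_lcos_assoc[OF Qc Ac that] QA by (auto simp: initial_map_def LCOSETS_def)
    show "initial_map Q A (g <# Q) = g <# A" using co g .
    show "initial_map Q A Q = A" using QA QQ by (simp add: initial_map_def)
    have "initial_map Q A B \<in> lcosets H" if "B \<in> lcosets Q" for B
      using that co l_coset_lcosets[OF sub[OF H] _ A] by (auto simp: LCOSETS_def)
    moreover have "initial_map Q A (g <# B) = g <# initial_map Q A B"
      if "g \<in> carrier G" "B \<in> lcosets Q" for g B
      using that co Qc Ac by (auto simp: LCOSETS_def lcos_m_assoc)
    ultimately show "initial_map Q A \<in> G_maps G Q H"
      by (auto simp: G_maps_def initial_map_def)
  qed
  have initQ: "initial_map Q Q = (\<lambda>B\<in>lcosets Q. B)"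
  proof (rule extensionalityI[of _ "lcosets Q"])
    fix B assume B: "B \<in> lcosets Q"
    then obtain g where "g \<in> carrier G" "B = g <# Q" by (auto simp: LCOSETS_def)
    then show "initial_map Q Q B = (\<lambda>B\<in>lcosets Q. B) B"
      using init(1)[OF Q QQ fixQ] B by simp
  qed (simp_all add: initial_map_def)
  \<comment> \<open>The action leaves the morphisms alone, so being fixed is a condition on the
    cosets only.\<close>
  have mem_F: "(ob, mor) \<in> simplices ?F n \<longleftrightarrow> (ob, mor) \<in> simplices (E_space G \<C>) n \<and>
      (\<forall>i\<le>n. \<forall>q\<in>Q. q <# snd (ob i) = snd (ob i))" for ob n
      and mor :: "nat \<Rightarrow> nat \<Rightarrow> 'a set \<Rightarrow> 'a set"
    by (auto simp: E_action_def fun_eq_iff case_prod_beta mem_simplices_E_space prod_eq_iff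
        PiE_def extensional_def split: if_splits)
  have cone_mem: "cone Q n s \<in> simplices ?F (Suc n)" if s: "s \<in> simplices ?F n" for n s
  proof -
    obtain ob mor where obm: "s = (ob, mor)" by (cases s)
    define ob' where "ob' = case_nat (Q, Q) ob"
    define mor' where "mor' i j = (case i of 0 \<Rightarrow> initial_map Q (snd (ob' j)) | Suc i \<Rightarrow> mor i (j - 1))"
      for i j
    have obD: "fst (ob i) \<in> \<C>" "snd (ob i) \<in> lcosets (fst (ob i))" "\<And>q. q \<in> Q \<Longrightarrow> q <# snd (ob i) = snd (ob i)"
      if "i \<le> n" for i
      using s that unfolding obm mem_F by (fastforce simp: mem_simplices_E_space PiE_def Pi_def)+
    have morD: "mor i j \<in> G_maps G (fst (ob i)) (fst (ob j))" "mor i j (snd (ob i)) = snd (ob j)"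
      if "i \<le> j" "j \<le> n" for i j
      using s that unfolding obm mem_F mem_simplices_E_space by blast+
    have ob'D: "fst (ob' i) \<in> \<C>" "snd (ob' i) \<in> lcosets (fst (ob' i))"
      "\<And>q. q \<in> Q \<Longrightarrow> q <# snd (ob' i) = snd (ob' i)"
      if "i \<le> Suc n" for i
      using that Q QQ fixQ obD by (auto simp: ob'_def split: nat.split)
    have hom: "mor' i j \<in> G_maps G (fst (ob' i)) (fst (ob' j)) \<and> mor' i j (snd (ob' i)) = snd (ob' j)"
      if ij: "i \<le> j" "j \<le> Suc n" for i j
    proof (cases i)
      case 0
      then show ?thesis
        using init(2,3)[OF ob'D[OF ij(2)] one_closed] by (simp add: mor'_def ob'_def)
    next
      case (Suc i')
      then obtain j' where "j = Suc j'" using ij Suc by (cases j) auto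
      then show ?thesis using Suc ij morD by (simp add: mor'_def ob'_def)
    qed
    have ident: "mor' i i = (\<lambda>B\<in>lcosets (fst (ob' i)). B)" if "i \<le> Suc n" for i
      using that s initQ unfolding obm mem_F mem_simplices_E_space
      by (cases i) (auto simp: mor'_def ob'_def)
    have comp: "mor' i k = compose (lcosets (fst (ob' i))) (mor' j k) (mor' i j)"
      if ijk: "i \<le> j" "j \<le> k" "k \<le> Suc n" for i j k
    proof (cases i)
      case 0
      \<comment> \<open>Uniqueness of maps out of the initial object: a \<open>G\<close>-map on the
        cosets of \<open>Q\<close> is determined by the image of \<open>Q\<close>.\<close>
      have "mor' 0 k B = mor' j k (mor' 0 j B)" if B: "B \<in> lcosets Q" for B
      proof -
        obtain g where g: "g \<in> carrier G" "B = g <# Q" using B by (auto simp: LCOSETS_def)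
        have j: "j \<le> Suc n" using ijk by simp
        have "mor' 0 k B = g <# snd (ob' k)" "mor' 0 j B = g <# snd (ob' j)"
          using init(1)[OF ob'D[OF ijk(3)] g(1)] init(1)[OF ob'D[OF j] g(1)] g
          by (simp_all add: mor'_def)
        moreover have "mor' j k (g <# snd (ob' j)) = g <# mor' j k (snd (ob' j))"
          using hom[OF ijk(2,3)] g ob'D[OF j] by (auto simp: G_maps_def)
        ultimately show ?thesis using hom[OF ijk(2,3)] by simp
      qed
      moreover have "mor' 0 k \<in> extensional (lcosets Q)"
        by (simp add: mor'_def initial_map_def)
      ultimately show ?thesis
        unfolding 0 by (intro extensionalityI[of _ "lcosets Q"]) (auto simp: ob'_def compose_def)
    next
      case (Suc i')
      then obtain j' k' where "j = Suc j'" "k = Suc k'" using ijk Suc by (cases j; cases k) auto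
      then show ?thesis
        using Suc ijk s unfolding obm mem_F mem_simplices_E_space by (simp add: mor'_def ob'_def)
    qed
    have "cone Q n s = (\<lambda>i\<in>{..Suc n}. ob' i, \<lambda>i j. if i \<le> j \<and> j \<le> Suc n then mor' i j else undefined)"
      unfolding cone_def obm mor'_def ob'_def Let_def by simp
    moreover have "\<dots> \<in> simplices ?F (Suc n)"
      unfolding mem_F mem_simplices_E_space
    proof (intro conjI allI impI ballI)
      fix i j k :: nat assume "i \<le> j \<and> j \<le> k \<and> k \<le> Suc n"
      then show "(if i \<le> k \<and> k \<le> Suc n then mor' i k else undefined) =
          compose (lcosets (fst ((\<lambda>i\<in>{..Suc n}. ob' i) i)))
            (if j \<le> k \<and> k \<le> Suc n then mor' j k else undefined)
            (if i \<le> j \<and> j \<le> Suc n then mor' i j else undefined)"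
        using comp[of i j k] by simp
    qed (auto simp: ob'D hom ident case_prod_beta simp del: atMost_Suc)
    ultimately show ?thesis by simp
  qed
  have apex_mem: "apex Q \<in> simplices ?F 0"
  proof -
    have "compose (lcosets Q) (\<lambda>B\<in>lcosets Q. B) (\<lambda>B\<in>lcosets Q. B) = (\<lambda>B\<in>lcosets Q. B)"
      by (auto simp: compose_def fun_eq_iff)
    then show ?thesis
      unfolding apex_def mem_F mem_simplices_E_space
      using Q QQ fixQ init(2,3)[OF Q QQ fixQ one_closed] by (auto simp: initQ)
  qed
  have face: "face (E_space G \<C>) (Suc n) i (ob, mor) =
      (\<lambda>j\<in>{..n}. ob (coface i j), \<lambda>j k. if j \<le> k \<and> k \<le> n then mor (coface i j) (coface i k) else undefined)"
    for n i ob and mor :: "nat \<Rightarrow> nat \<Rightarrow> 'a set \<Rightarrow> 'a set"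
    by (simp add: face_def E_space_def nerve_def)
  have face0: "face ?F (Suc n) 0 (cone Q n s) = s" if s: "s \<in> simplices ?F n" for n s
  proof -
    obtain ob mor where obm: "s = (ob, mor)" by (cases s)
    show ?thesis
      using s unfolding obm mem_F mem_simplices_E_space
      by (auto simp: cone_def face Let_def coface_def fun_eq_iff PiE_def extensional_def)
  qed
  have face1: "face ?F (Suc 0) (Suc 0) (cone Q 0 s) = apex Q" for s
    by (cases s) (auto simp: cone_def face Let_def coface_def fun_eq_iff apex_def)
  have face_Suc: "face ?F (Suc (Suc n)) (Suc i) (cone Q (Suc n) s) = cone Q n (face ?F (Suc n) i s)"
    if "i \<le> Suc n" for n i s
  proof -
    \<comment> \<open>A face of positive index keeps the apex and acts as \<open>coface i\<close> on
      the remaining vertices.\<close>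
    have c: "coface (Suc i) 0 = 0" "coface (Suc i) (Suc j) = Suc (coface i j)" for j
      by (auto simp: coface_def)
    have le: "coface i j \<le> Suc n" if "j \<le> n" for j
      using that by (simp add: coface_def)
    have mono: "coface i j \<le> coface i k" if "j \<le> k" for j k
      using that by (auto simp: coface_def)
    show ?thesis
      using that by (cases s)
        (auto simp: cone_def face Let_def fun_eq_iff c le mono split: nat.split)
  qed
  show ?thesis
    unfolding extra_degeneracy_def
    using apex_mem cone_mem face0 face1 face_Suc by blast
qed

section \<open>Centralizers and products of commuting subgroups\<close>

lemma subgroup_centralizer:
  assumes "P \<subseteq> carrier G"
  shows "subgroup (centralizer G P) G"
proof (rule subgroupI)
  show "centralizer G P \<noteq> {}"
    using assms one_closed by (auto simp: centralizer_def intro!: exI[of _ \<one>])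
next
  fix g assume g: "g \<in> centralizer G P"
  have "inv g \<otimes> x = x \<otimes> inv g" if "x \<in> P" for x
  proof -
    have "x \<in> carrier G" "g \<in> carrier G" "g \<otimes> x = x \<otimes> g"
      using that g assms by (auto simp: centralizer_def)
    then show ?thesis by (metis inv_closed inv_solve_left inv_solve_right m_assoc m_closed)
  qed
  then show "inv g \<in> centralizer G P" using g by (auto simp: centralizer_def)
next
  fix g h assume "g \<in> centralizer G P" "h \<in> centralizer G P"
  then show "g \<otimes> h \<in> centralizer G P"
    using assms by (auto simp: centralizer_def subset_iff m_assoc) (metis m_assoc)
qed (auto simp: centralizer_def)

text \<open>Because the factors commute, multiplication is a homomorphism from their direct product;
  its image has order dividing a product of powers of \<open>p\<close>.\<close>

lemma p_subgroup_set_mult: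
  assumes p: "Factorial_Ring.prime p" and P: "p_subgroup p P G" and Q: "p_subgroup p Q G"
    and comm: "\<And>x y. x \<in> P \<Longrightarrow> y \<in> Q \<Longrightarrow> x \<otimes> y = y \<otimes> x"
  shows "p_subgroup p (P <#> Q) G"
proof -
  let ?D = "G\<lparr>carrier := P\<rparr> \<times>\<times> G\<lparr>carrier := Q\<rparr>"
  let ?h = "\<lambda>(x, y). x \<otimes> y"
  have sub: "subgroup P G" "subgroup Q G" using P Q by (auto simp: p_subgroup_def)
  have carr: "x \<in> carrier G" if "x \<in> P \<or> x \<in> Q" for x
    using sub that by (auto dest: subgroup.mem_carrier)
  have D: "group ?D"
    using sub by (intro DirProd_group subgroup_imp_group)
  have img: "?h ` carrier ?D = P <#> Q" by (auto simp: set_mult_def)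
  have "x \<otimes> x' \<otimes> (y \<otimes> y') = x \<otimes> y \<otimes> (x' \<otimes> y')"
    if "x \<in> P" "x' \<in> P" "y \<in> Q" "y' \<in> Q" for x x' y y'
    using that comm[of x' y] carr by (smt (verit) m_assoc m_closed)
  then have hom: "?h \<in> hom ?D G"
    using carr by (auto simp: hom_def)
  interpret h: group_hom ?D G ?h
    using D hom is_group by (simp add: group_hom_def group_hom_axioms_def)
  have PQ: "subgroup (P <#> Q) G" using h.img_is_subgroup unfolding img .
  \<comment> \<open>The codomain is cut down to the image, so that the isomorphism theorem for
    surjections applies.\<close>
  interpret h': group_hom ?D "G\<lparr>carrier := P <#> Q\<rparr>" ?h
    using D subgroup_imp_group[OF PQ] hom img
    by (auto simp: group_hom_def group_hom_axioms_def hom_def)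
  let ?K = "kernel ?D (G\<lparr>carrier := P <#> Q\<rparr>) ?h"
  have "(\<lambda>Z. the_elem (?h ` Z)) \<in> iso (?D Mod ?K) (G\<lparr>carrier := P <#> Q\<rparr>)"
    by (rule h'.FactGroup_iso_set) (simp add: img[simplified])
  then have "card (rcosets\<^bsub>?D\<^esub> ?K) = card (P <#> Q)"
    by (auto simp: iso_def FactGroup_def dest: bij_betw_same_card)
  moreover have "card (rcosets\<^bsub>?D\<^esub> ?K) * card ?K = card P * card Q"
    using group.lagrange[OF D h'.subgroup_kernel] by (simp add: order_def card_cartesian_product)
  ultimately have "card (P <#> Q) dvd card P * card Q" by (metis dvd_triv_left)
  moreover obtain a b where "card P = p ^ a" "card Q = p ^ b"
    using P Q by (auto simp: p_subgroup_def)
  ultimately have "card (P <#> Q) dvd p ^ (a + b)" by (simp add: power_add)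
  then show ?thesis using PQ p by (auto simp: p_subgroup_def divides_primepow_nat)
qed

end

section \<open>Acyclicity of the orbit space under the centralizer\<close>

theorem proposition11p2:
  fixes G :: "('a, 'b) monoid_scheme" and p :: nat and \<C> :: "'a set set" and P :: "'a set"
  assumes "group G" and "finite (carrier G)" and "Factorial_Ring.prime p"
    and "p_collection p G \<C>" and "closed_under_p_overgroups p G \<C>"
    and "P \<in> \<C>"
  shows "Zp_acyclic p
    (orbit_space G (centralizer G P) (E_action G)
      (fixed_points (E_space G \<C>) (E_action G) P))"
proof -
  interpret group G by fact
  let ?C = "centralizer G P"
  let ?K = "G\<lparr>carrier := ?C\<rparr>"
  let ?R = "Z_localized p"
  let ?Y = "fixed_points (E_space G \<C>) (E_action G) P"
  have pC: "p_subgroup p H G" if "H \<in> \<C>" for H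
    using assms(4) that by (simp add: p_collection_def)
  have sub: "subgroup H G" if "H \<in> \<C>" for H
    using pC[OF that] by (simp add: p_subgroup_def)
  have P: "subgroup P G" "P \<subseteq> carrier G"
    using sub[OF assms(6)] subgroup.subset by auto
  have C: "subgroup ?C G" by (rule subgroup_centralizer[OF P(2)])
  interpret E: simplicial_action G "E_space G \<C>" "E_action G"
    by (rule simplicial_action_E_space[OF sub])
  interpret K: simplicial_action ?K ?Y "E_action G"
    by (rule E.simplicial_action_fixed_points[OF C P(2)]) (simp add: centralizer_def)
  interpret R: coefficient_ring ?R
    by (rule coefficient_ring_Z_localized[OF assms(3)])
  have finC: "finite ?C"
    using assms(2) by (simp add: centralizer_def)
  have "card ?C \<noteq> 0"
    using finC subgroup.one_closed[OF C] by auto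
  \<comment> \<open>\<open>m\<close> is the part of the order prime to \<open>p\<close>, which
    becomes the index of the Sylow subgroup.\<close>
  then obtain m where m: "card ?C = p ^ multiplicity p (card ?C) * m" "\<not> p dvd m"
    using multiplicity_decompose'[of "card ?C" p] assms(3) by (metis not_prime_unit)
  obtain S where S: "subgroup S ?K" "card S = p ^ multiplicity p (card ?C)"
    using sylow_thm[of p ?K "multiplicity p (card ?C)" m] assms(3) K.is_group m(1) finC
    by (auto simp: order_def)
  have "card (rcosets\<^bsub>?K\<^esub> S) = m"
  proof -
    have "p ^ multiplicity p (card ?C) \<noteq> 0"
      using prime_gt_0_nat[OF assms(3)] by simp
    moreover have "card (rcosets\<^bsub>?K\<^esub> S) * p ^ multiplicity p (card ?C) =
        m * p ^ multiplicity p (card ?C)"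
      using K.lagrange[OF S(1)] S(2) m(1) by (simp add: order_def mult.commute)
    ultimately show ?thesis by (metis mult_right_cancel)
  qed
  then have idx: "inverse (of_nat (card (rcosets\<^bsub>?K\<^esub> S))) \<in> ?R"
  proof -
    have "inverse (of_nat m) = (of_int 1 / of_int (int m) :: rat)"
      by (simp add: inverse_eq_divide)
    moreover have "\<not> int p dvd int m" using m(2) by simp
    ultimately show ?thesis
      unfolding \<open>card (rcosets\<^bsub>?K\<^esub> S) = m\<close> Z_localized_def by blast
  qed
  have "acyclic_over ?R (fixed_points ?Y (E_action G) Q)" if Q: "subgroup Q ?K" "Q \<subseteq> S" for Q
  proof -
    have QG: "subgroup Q G" by (rule incl_subgroup[OF C Q(1)])
    have comm: "x \<otimes>\<^bsub>G\<^esub> y = y \<otimes>\<^bsub>G\<^esub> x" if "x \<in> P" "y \<in> Q" for x y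
      using subgroup.subset[OF Q(1)] that by (auto simp: centralizer_def)
    have "card Q dvd card S"
    proof -
      have "subgroup Q (?K\<lparr>carrier := S\<rparr>)"
        using K.subgroup_incl[OF Q(1) S(1) Q(2)] .
      then show ?thesis
        using group.lagrange[OF K.subgroup_imp_group[OF S(1)]] by (simp add: order_def) (metis dvd_triv_right)
    qed
    then have "p_subgroup p Q G"
      using QG assms(3) by (auto simp: p_subgroup_def S(2) divides_primepow_nat)
    then have "p_subgroup p (P <#>\<^bsub>G\<^esub> Q) G"
      using p_subgroup_set_mult[OF assms(3) pC[OF assms(6)]] comm by blast
    moreover have "P \<subseteq> P <#>\<^bsub>G\<^esub> Q"
      using subgroup.one_closed[OF QG] P(2) by (force simp: set_mult_def)
    \<comment> \<open>Closure under \<open>p\<close>-overgroups enters here: it makes the apex of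
      the cone an object of the category.\<close>
    ultimately have "P <#>\<^bsub>G\<^esub> Q \<in> \<C>"
      using assms(5,6) by (auto simp: closed_under_p_overgroups_def)
    then show ?thesis
      unfolding E.fixed_points_fixed_points[OF P(1) QG]
      by (intro R.acyclic_over_extra_degeneracy[OF extra_degeneracy_fixed_points_E_space[OF sub]])
  qed
  then have "acyclic_over ?R (orbit_space ?K (carrier ?K) (E_action G) ?Y)"
    using K.acyclic_over_orbit_space[OF R.coefficient_ring_axioms _ S(1) idx] finC by simp
  moreover have "simplicial_set (orbit_space ?K (carrier ?K) (E_action G) ?Y)"
    by (rule simplicial_set_orbit_space[OF K.simplicial])
      (use K.act_closed K.act_smap in auto)
  \<comment> \<open>\<open>orbit_space\<close> overwrites the carrier, so both sides use the same
    group.\<close>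
  moreover have "orbit_space ?K (carrier ?K) (E_action G) ?Y = orbit_space G ?C (E_action G) ?Y"
    by (simp add: orbit_space_def)
  ultimately show ?thesis using Zp_acyclicI[OF assms(3)] by simp
qed

end
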